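(* Let $\kappa$ be an infinite cardinal, $D$ a tournament with $|V(D)|=\kappa$, and $\mu=\mathrm{cf}(\kappa)$. (i) If every vertex of $D$ has out-degree $<\kappa$, then there are $\mathcal C\in\mathrm{rs}(D)$ and a partition $V(D)=\bigsqcup\{V_\xi:\xi<\mu\}$ with $|V_\xi|<\kappa$ for all $\xi$, such that $uv\in A(D^{\mathcal C})$ whenever $u\in V_\xi$, $v\in V_\zeta$ and $\zeta<\xi$. (ii) If every vertex of $D$ has in-degree $<\kappa$, then there are $\mathcal C\in\mathrm{rs}(D)$ and a partition $V(D)=\bigsqcup\{V_\xi:\xi<\mu\}$ with $|V_\xi|<\kappa$ for all $\xi$, such that $uv\in A(D^{\mathcal C})$ whenever $v\in V_\xi$, $u\in V_\zeta$ and $\zeta<\xi$.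
   Context: A tournament is a digraph (no loops) in which for all distinct $u,v$ exactly one of $uv$, $vu$ is an arc. For a directed cycle $C$, $D^{C}$ is the digraph on $V(D)$ with arc set $(A(D)\setminus A(C))\cup\{vu: uv\in A(C)\}$. Reversal sequences $\mathrm{rs}(D)$ and $D^{\mathcal C}$ are defined by transfinite recursion: (1) $\emptyset\in\mathrm{rs}(D)$, $D^\emptyset=D$; (2) if $\mathcal C\in\mathrm{rs}(D)$ and $C^*$ is a directed cycle of $D^{\mathcal C}$ then $\mathcal C^\frown\langle C^*\rangle\in\mathrm{rs}(D)$ and $D^{\mathcal C^\frown\langle C^*\rangle}=(D^{\mathcal C})^{C^*}$; (3) if $\mathcal C_\xi\in\mathrm{rs}(D)$ ($\xi<\zeta$) is an increasing (end-extending) sequence whose union $\mathcal C$ is locally finite (each edge lies in only finitely many cycles of $\mathcal C$), then $\mathcal C\in\mathrm{rs}(D)$ and $uv\in A(D^{\mathcal C})$ iff for some $\nu<\zeta$, $uv\in A(D^{\mathcal C_\xi})$ for all $\nu<\xi<\zeta$. $\mathrm{cf}(\kappa)$ is the cofinality of $\kappa$. *)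

theory Defs
  imports "Graph_Theory.Pair_Digraph" "HOL-Library.Disjoint_Sets"
begin

unbundle cardinal_syntax

locale tournament = pair_loopfree_digraph +
  assumes exactly_one_arc:
    "\<lbrakk>u \<in> pverts G; v \<in> pverts G; u \<noteq> v\<rbrakk> \<Longrightarrow> ((u, v) \<in> parcs G) \<noteq> ((v, u) \<in> parcs G)"

text \<open>The least cardinality of a cofinal subset. The strict notion \<^const>\<open>cofinal\<close> of the
  library (every element has a strictly larger one in the subset) is the usual one here, because an
  infinite cardinal has no largest element.\<close>

definition cofinality :: "'k rel \<Rightarrow> 'k rel" where
  "cofinality r = |SOME A. A \<subseteq> Field r \<and> cofinal A r \<and>
                        (\<forall>B. B \<subseteq> Field r \<and> cofinal B r \<longrightarrow> |A| \<le>o |B| )|"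

lemma cofinality_exists:
  assumes "Card_order r" and "infinite (Field r)"
  shows "\<exists>A. A \<subseteq> Field r \<and> cofinal A r \<and>
             cofinality r = |A| \<and> (\<forall>B. B \<subseteq> Field r \<and> cofinal B r \<longrightarrow> |A| \<le>o |B| )"
proof -
  let ?R = "{|A| | A. A \<subseteq> Field r \<and> cofinal A r}"
  let ?P = "\<lambda>A. A \<subseteq> Field r \<and> cofinal A r \<and>
                (\<forall>B. B \<subseteq> Field r \<and> cofinal B r \<longrightarrow> |A| \<le>o |B| )"
  have "cofinal (Field r) r"
    unfolding cofinal_def using infinite_Card_order_limit[OF assms] by (metis FieldI2)
  then have "?R \<noteq> {}" by blast
  moreover have "\<forall>s\<in>?R. Well_order s" by (auto simp: card_of_Well_order)
  ultimately obtain s where "s \<in> ?R" "\<forall>s'\<in>?R. s \<le>o s'"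
    using exists_minim_Well_order[of ?R] by blast
  then have "\<exists>A. ?P A" by blast
  then have "?P (SOME A. ?P A)" by (rule someI_ex)
  then show ?thesis unfolding cofinality_def by blast
qed

text \<open>A directed cycle is identified with its set of arcs.\<close>

definition dicycles :: "'a pair_pre_digraph \<Rightarrow> 'a rel set" where
  "dicycles D = {set p | p. pre_digraph.cycle (with_proj D) p}"

definition reverse_cycle :: "'a pair_pre_digraph \<Rightarrow> 'a rel \<Rightarrow> 'a pair_pre_digraph" where
  "reverse_cycle D C = D\<lparr>parcs := (parcs D - C) \<union> C\<inverse>\<rparr>"

text \<open>A transfinite sequence of cycles is a partial map whose domain is an initial segment of the
  ordinals below \<open>\<lambda>\<close>, the successor cardinal of \<open>\<aleph>\<^sub>0 + |V(D)|\<close>. This bound excludes nothing: in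
  a locally finite sequence each of the at most \<open>\<aleph>\<^sub>0 + |V(D)|\<close> edges lies in finitely many cycles
  and every cycle has an edge, so the length of the sequence is below \<open>\<lambda>\<close>.\<close>

type_synonym 'a position = "(nat + 'a) set"
type_synonym 'a cycle_seq = "'a position \<rightharpoonup> 'a rel"

definition positions :: "'a pair_pre_digraph \<Rightarrow> 'a position rel" where
  "positions D = cardSuc (natLeq +c |pverts D| )"

text \<open>Edges are taken without direction, since a reversed arc stays the same edge; a cycle that
  occurs at several positions of the sequence is counted at each of them.\<close>

definition cycles_through :: "'a cycle_seq \<Rightarrow> 'a \<Rightarrow> 'a \<Rightarrow> 'a position set" where
  "cycles_through S u v = {\<alpha>. \<exists>C. S \<alpha> = Some C \<and> ((u, v) \<in> C \<or> (v, u) \<in> C)}"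

definition locally_finite :: "'a cycle_seq \<Rightarrow> bool" where
  "locally_finite S \<longleftrightarrow> (\<forall>u v. finite (cycles_through S u v))"

text \<open>\<open>reversal D S E\<close> says that \<open>S\<close> is a reversal sequence of \<open>D\<close> and that \<open>E\<close> is the digraph
  it produces. In the last rule the well-order \<open>\<zeta>\<close> without a last element is the limit ordinal
  that indexes the increasing sequence of reversal sequences; as their domains are initial segments
  of the same well-order, \<open>\<subseteq>\<^sub>m\<close> is end-extension.\<close>

inductive reversal ::
  "'a pair_pre_digraph \<Rightarrow> 'a cycle_seq \<Rightarrow> 'a pair_pre_digraph \<Rightarrow> bool"
  for D :: "'a pair_pre_digraph" where
  empty: "reversal D Map.empty D"
| snoc: "\<lbrakk>reversal D S E; \<alpha> \<in> Field (positions D); dom S = underS (positions D) \<alpha>;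
          C \<in> dicycles E\<rbrakk>
         \<Longrightarrow> reversal D (S(\<alpha> \<mapsto> C)) (reverse_cycle E C)"
| limit: "\<lbrakk>Well_order (\<zeta> :: 'a position rel); Field \<zeta> \<noteq> {}; \<forall>\<xi>\<in>Field \<zeta>. aboveS \<zeta> \<xi> \<noteq> {};
           \<forall>\<xi>\<in>Field \<zeta>. reversal D (S \<xi>) (E \<xi>);
           \<forall>\<xi> \<eta>. (\<xi>, \<eta>) \<in> \<zeta> \<longrightarrow> S \<xi> \<subseteq>\<^sub>m S \<eta>;
           Map.graph T = (\<Union>\<xi>\<in>Field \<zeta>. Map.graph (S \<xi>)); locally_finite T\<rbrakk>
          \<Longrightarrow> reversal D T
               (D\<lparr>parcs := {(u, v). \<exists>\<nu>\<in>Field \<zeta>. \<forall>\<xi>\<in>aboveS \<zeta> \<nu>. (u, v) \<in> parcs (E \<xi>)}\<rparr>)"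

definition rs :: "'a pair_pre_digraph \<Rightarrow> 'a cycle_seq set" where
  "rs D = {S. \<exists>E. reversal D S E}"

definition after_reversal :: "'a pair_pre_digraph \<Rightarrow> 'a cycle_seq \<Rightarrow> 'a pair_pre_digraph" where
  "after_reversal D S = (THE E. reversal D S E)"

text \<open>The digraph \<open>E\<close> in \<open>reversal D S E\<close> is determined by \<open>D\<close> and \<open>S\<close>: an edge that lies on some
  cycle of \<open>S\<close> gets its direction from the last such cycle.\<close>

lemma positions_Well_order: "Well_order (positions D)"
  unfolding positions_def
  by (rule card_order_on_well_order_on[OF cardSuc_Card_order[OF Card_order_csum]])

lemma cycles_through_dom: "cycles_through S u v \<subseteq> dom S"
  by (auto simp: cycles_through_def)

definition last_through :: "'a pair_pre_digraph \<Rightarrow> 'a cycle_seq \<Rightarrow> 'a \<Rightarrow> 'a \<Rightarrow> 'a position \<Rightarrow> bool" where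
  "last_through D S u v \<alpha> \<longleftrightarrow>
     \<alpha> \<in> cycles_through S u v \<and> (\<forall>\<beta>\<in>cycles_through S u v. (\<beta>, \<alpha>) \<in> positions D)"

lemma ex_last_through:
  assumes "finite (cycles_through S u v)" "cycles_through S u v \<noteq> {}" "dom S \<subseteq> Field (positions D)"
  shows "\<exists>\<alpha>. last_through D S u v \<alpha>"
proof -
  have "F \<noteq> {} \<longrightarrow> F \<subseteq> Field (positions D) \<longrightarrow> (\<exists>\<alpha>\<in>F. \<forall>\<beta>\<in>F. (\<beta>, \<alpha>) \<in> positions D)"
    if "finite F" for F
    using that
  proof induction
    case empty
    then show ?case by simp
  next
    case (insert x F)
    show ?case
    proof (intro impI)
      assume sub: "insert x F \<subseteq> Field (positions D)"
      have lin: "Linear_order (positions D)"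
        using positions_Well_order well_order_on_def by blast
      then have refl: "(x, x) \<in> positions D"
        using sub by (auto simp: order_on_defs refl_on_def)
      show "\<exists>\<alpha>\<in>insert x F. \<forall>\<beta>\<in>insert x F. (\<beta>, \<alpha>) \<in> positions D"
      proof (cases "F = {}")
        case True
        then show ?thesis using refl by simp
      next
        case False
        then obtain a where a: "a \<in> F" "\<forall>\<beta>\<in>F. (\<beta>, a) \<in> positions D"
          using insert.IH sub by auto
        then have "a \<in> Field (positions D)" "x \<in> Field (positions D)" using sub by auto
        moreover have "total_on (Field (positions D)) (positions D)"
          using lin by (simp add: order_on_defs)
        ultimately consider "(x, a) \<in> positions D" | "(a, x) \<in> positions D"
          using refl unfolding total_on_def by metis
        then show ?thesis
        proof cases
          case 1
          then show ?thesis using a by blast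
        next
          case 2
          have "trans (positions D)" using lin by (simp add: order_on_defs)
          then have "(\<beta>, x) \<in> positions D" if "\<beta> \<in> F" for \<beta>
            using a(2) that 2 by (meson transD)
          then show ?thesis using refl by blast
        qed
      qed
    qed
  qed
  from this[OF assms(1)] have "\<exists>\<alpha>\<in>cycles_through S u v. \<forall>\<beta>\<in>cycles_through S u v. (\<beta>, \<alpha>) \<in> positions D"
    using assms(2,3) cycles_through_dom[of S u v] by simp
  then show ?thesis unfolding last_through_def by blast
qed

lemma reversal_char:
  assumes "reversal D S E"
  shows "dom S \<subseteq> Field (positions D) \<and> pverts E = pverts D \<and> locally_finite S \<and>
    (\<forall>u v. (cycles_through S u v = {} \<longrightarrow> ((u, v) \<in> parcs E \<longleftrightarrow> (u, v) \<in> parcs D)) \<and>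
      (\<forall>\<alpha>. last_through D S u v \<alpha> \<longrightarrow> ((u, v) \<in> parcs E \<longleftrightarrow> (v, u) \<in> the (S \<alpha>))))"
  using assms
proof induction
  case empty
  then show ?case by (auto simp: locally_finite_def cycles_through_def last_through_def)
next
  case (snoc S E \<alpha> C)
  let ?S = "S(\<alpha> \<mapsto> C)"
  have "\<alpha> \<notin> dom S" using snoc.hyps by (simp add: underS_def)
  then have new: "cycles_through ?S u v =
      (if (u, v) \<in> C \<or> (v, u) \<in> C then insert \<alpha> (cycles_through S u v) else cycles_through S u v)"
    for u v by (auto simp: cycles_through_def domIff)
  have asym: "antisym (positions D)"
    using positions_Well_order[of D] by (simp add: order_on_defs)
  have "((u, v) \<in> parcs (reverse_cycle E C) \<longleftrightarrow> (v, u) \<in> the (?S \<beta>))"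
    if l: "last_through D ?S u v \<beta>" for u v \<beta>
  proof (cases "(u, v) \<in> C \<or> (v, u) \<in> C")
    case True
    then have "(\<alpha>, \<beta>) \<in> positions D" "\<beta> \<in> insert \<alpha> (dom S)"
      using l new[of u v] cycles_through_dom[of S u v] by (auto simp: last_through_def)
    then have "\<beta> = \<alpha>"
      using snoc.hyps asym by (auto simp: underS_def dest: antisymD)
    then show ?thesis using True by (auto simp: reverse_cycle_def)
  next
    case False
    then have "last_through D S u v \<beta>" using l new by (simp add: last_through_def)
    moreover from this have "\<beta> \<in> dom S"
      using cycles_through_dom[of S u v] unfolding last_through_def by blast
    then have "\<beta> \<noteq> \<alpha>" using \<open>\<alpha> \<notin> dom S\<close> by blast
    ultimately show ?thesis using snoc.IH False by (auto simp: reverse_cycle_def)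
  qed
  moreover have "(u, v) \<in> parcs (reverse_cycle E C) \<longleftrightarrow> (u, v) \<in> parcs D"
    if "cycles_through ?S u v = {}" for u v
    using that new snoc.IH by (auto simp: reverse_cycle_def split: if_splits)
  moreover have "locally_finite ?S" using snoc.IH new by (simp add: locally_finite_def)
  moreover have "dom ?S \<subseteq> Field (positions D)" using snoc.IH snoc.hyps(2) by simp
  moreover have "pverts (reverse_cycle E C) = pverts D"
    using snoc.IH by (simp add: reverse_cycle_def)
  ultimately show ?case by blast
next
  case (limit \<zeta> S E T)
  have T: "T \<alpha> = Some C \<longleftrightarrow> (\<exists>\<xi>\<in>Field \<zeta>. S \<xi> \<alpha> = Some C)" for \<alpha> C
    using limit.hyps(5) unfolding Map.graph_def by (simp add: set_eq_iff)
  then have sub: "cycles_through (S \<xi>) u v \<subseteq> cycles_through T u v" if "\<xi> \<in> Field \<zeta>" for \<xi> u v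
    using that unfolding cycles_through_def by blast
  let ?L = "{(u, v). \<exists>\<nu>\<in>Field \<zeta>. \<forall>\<xi>\<in>aboveS \<zeta> \<nu>. (u, v) \<in> parcs (E \<xi>)}"
  have eventually: "(u, v) \<in> ?L \<longleftrightarrow> b"
    if x: "x \<in> Field \<zeta>" and ev: "\<And>\<xi>. (x, \<xi>) \<in> \<zeta> \<Longrightarrow> (u, v) \<in> parcs (E \<xi>) \<longleftrightarrow> b" for x u v b
  proof
    assume "(u, v) \<in> ?L"
    then obtain \<nu> where \<nu>: "\<nu> \<in> Field \<zeta>" "\<forall>\<xi>\<in>aboveS \<zeta> \<nu>. (u, v) \<in> parcs (E \<xi>)" by blast
    have lin: "Linear_order \<zeta>" using limit.hyps(1) well_order_on_def by blast
    then have tr: "trans \<zeta>" and an: "antisym \<zeta>" by (auto simp: order_on_defs)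
    obtain y where y: "y \<in> {x, \<nu>}" "(x, y) \<in> \<zeta>" "(\<nu>, y) \<in> \<zeta>"
      using lin x \<nu>(1) by (force simp: order_on_defs refl_on_def total_on_def)
    then have "y \<in> Field \<zeta>" by (auto simp: Field_def)
    then obtain z where "z \<in> aboveS \<zeta> y" using limit.hyps(3) by blast
    then have z: "(y, z) \<in> \<zeta>" "z \<noteq> y" by (auto simp: aboveS_def)
    then have "(x, z) \<in> \<zeta>" "(\<nu>, z) \<in> \<zeta>" "z \<noteq> \<nu>"
      using tr y an by (auto dest: transD antisymD)
    then show b using ev \<nu>(2) by (auto simp: aboveS_def)
  next
    assume b
    then show "(u, v) \<in> ?L" using x ev by (auto simp: aboveS_def)
  qed
  have "(u, v) \<in> ?L \<longleftrightarrow> (u, v) \<in> parcs D" if "cycles_through T u v = {}" for u v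
  proof -
    obtain x where x: "x \<in> Field \<zeta>" using limit.hyps(2) by blast
    show ?thesis
    proof (rule eventually[OF x])
      fix \<xi> assume "(x, \<xi>) \<in> \<zeta>"
      then have \<xi>: "\<xi> \<in> Field \<zeta>" by (rule FieldI2)
      then have "cycles_through (S \<xi>) u v = {}" using sub[OF \<xi>, of u v] that by simp
      then show "(u, v) \<in> parcs (E \<xi>) \<longleftrightarrow> (u, v) \<in> parcs D" using limit.IH \<xi> by simp
    qed
  qed
  moreover have "(u, v) \<in> ?L \<longleftrightarrow> (v, u) \<in> the (T \<alpha>)" if l: "last_through D T u v \<alpha>" for u v \<alpha>
  proof -
    obtain C where C: "T \<alpha> = Some C" "(u, v) \<in> C \<or> (v, u) \<in> C"
      using l by (auto simp: last_through_def cycles_through_def)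
    then obtain x where x: "x \<in> Field \<zeta>" "S x \<alpha> = Some C" using T by blast
    show ?thesis
    proof (rule eventually[OF x(1)])
      fix \<xi> assume "(x, \<xi>) \<in> \<zeta>"
      then have \<xi>: "\<xi> \<in> Field \<zeta>" "S x \<subseteq>\<^sub>m S \<xi>" using limit.hyps by (auto simp: Field_def)
      then have S: "S \<xi> \<alpha> = Some C" using x(2) by (metis domI map_le_def)
      then have "\<alpha> \<in> cycles_through (S \<xi>) u v" using C(2) by (auto simp: cycles_through_def)
      then have "last_through D (S \<xi>) u v \<alpha>"
        using l sub[OF \<xi>(1)] by (auto simp: last_through_def)
      then show "(u, v) \<in> parcs (E \<xi>) \<longleftrightarrow> (v, u) \<in> the (T \<alpha>)"
        using limit.IH \<xi>(1) S C(1) by simp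
    qed
  qed
  moreover have "dom T \<subseteq> Field (positions D)"
  proof
    fix \<alpha> assume "\<alpha> \<in> dom T"
    then obtain \<xi> where "\<xi> \<in> Field \<zeta>" "\<alpha> \<in> dom (S \<xi>)" using T by blast
    then show "\<alpha> \<in> Field (positions D)" using limit.IH by blast
  qed
  ultimately show ?case using limit.hyps by simp
qed

lemma reversal_unique:
  assumes E: "reversal D S E" and F: "reversal D S F"
  shows "E = F"
proof -
  note e = reversal_char[OF E] and f = reversal_char[OF F]
  have "(u, v) \<in> parcs E \<longleftrightarrow> (u, v) \<in> parcs F" for u v
  proof (cases "cycles_through S u v = {}")
    case True
    then show ?thesis using e f by simp
  next
    case False
    then obtain \<alpha> where "last_through D S u v \<alpha>"
      using ex_last_through[of S u v D] e by (auto simp: locally_finite_def)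
    then show ?thesis using e f by simp
  qed
  then have "parcs E = parcs F" by auto
  then show ?thesis using e f by simp
qed

lemma after_reversal_eq: "reversal D S E \<Longrightarrow> after_reversal D S = E"
  unfolding after_reversal_def using reversal_unique by blast

end

theory Submission
  imports Defs
begin

text \<open>Write \<open>N v\<close> for the out-neighbourhood of \<open>v\<close> and let all out-degrees be below \<open>\<kappa>\<close>. It suffices
  to cover the vertices by \<open>cf(\<kappa>)\<close> sets of size below \<open>\<kappa>\<close>, each of which has no outgoing arc after
  the reversals.

  If \<open>\<kappa>\<close> is regular and uncountable, the sets of vertices reachable from a given vertex will do, without
  any reversal.

  If \<open>\<kappa>\<close> is singular, an arc \<open>u \<rightarrow> v\<close> with \<open>|N u| < |N v|\<close> can be turned around alone: choose
  \<open>x\<^sub>0, x\<^sub>1, \<dots>\<close> in \<open>N v - N u\<close> and reverse \<open>u v x\<^sub>0\<close>, \<open>u x\<^sub>0 v x\<^sub>1\<close>,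
  \<open>u x\<^sub>1 v x\<^sub>2\<close>, and so on. With suitably disjoint choices this is done for all such arcs, and then the
  sets \<open>{v. |N v| \<le> \<lambda>}\<close> for \<open>\<lambda> < \<kappa>\<close> have no outgoing arc; a tournament has at most
  \<open>\<lambda>\<^sup>+\<close> vertices of out-degree at most \<open>\<lambda>\<close>.

  If \<open>\<kappa>\<close> is countable, consider a finite set with the least number of outgoing arcs among the finite
  sets that contain a given one. The head of an outgoing arc \<open>u \<rightarrow> v\<close> then starts a ray outside
  the set, and reversing the triangles that \<open>u\<close> forms with the successive arcs of the ray pushes
  the arc to infinity. After finitely many such steps no arc leaves the set.\<close>

section \<open>Runs of cycle reversals\<close>

definition touches :: "'a rel \<Rightarrow> 'a \<Rightarrow> 'a \<Rightarrow> bool" where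
  "touches C u v \<longleftrightarrow> (u, v) \<in> C \<or> (v, u) \<in> C"

text \<open>A cycle through an edge turns it around, so the orientation of an edge depends only on the
  parity of the number of cycles through it. This keeps the state of a run independent of the order.\<close>

definition reoriented :: "'a rel \<Rightarrow> ('i \<Rightarrow> 'a rel) \<Rightarrow> 'i set \<Rightarrow> 'a rel" where
  "reoriented R C I =
     {(u, v). if even (card {i\<in>I. touches (C i) u v}) then (u, v) \<in> R else (v, u) \<in> R}"

text \<open>Both constructions reverse nothing but triangles and 4-cycles, so only these two shapes
  have to be matched with \<open>dicycles\<close>.\<close>

definition short_cycle :: "'a rel \<Rightarrow> bool" where
  "short_cycle C \<longleftrightarrow>
     (\<exists>a b c. distinct [a, b, c] \<and> C = {(a, b), (b, c), (c, a)}) \<or>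
     (\<exists>a b c d. distinct [a, b, c, d] \<and> C = {(a, b), (b, c), (c, d), (d, a)})"

text \<open>This is \<open>reversal\<close> over an arbitrary well-ordered index type and without
  explicit limit stages: the parity formula gives the state before each cycle directly, and
  positions enter only in \<open>reversal_run_realized\<close>.\<close>

definition reversal_run :: "'a rel \<Rightarrow> 'i rel \<Rightarrow> ('i \<Rightarrow> 'a rel) \<Rightarrow> bool" where
  "reversal_run R r C \<longleftrightarrow> Well_order r \<and>
     (\<forall>i\<in>Field r. short_cycle (C i) \<and> C i \<subseteq> reoriented R C (underS r i)) \<and>
     (\<forall>u v. finite {i\<in>Field r. touches (C i) u v})"

lemma touches_commute: "touches C u v \<longleftrightarrow> touches C v u"
  by (auto simp: touches_def)

lemma touches_converse [simp]: "touches (C\<inverse>) u v \<longleftrightarrow> touches C u v"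
  by (auto simp: touches_def)

lemma mem_reoriented:
  "(u, v) \<in> reoriented R C I \<longleftrightarrow>
     (if even (card {i\<in>I. touches (C i) u v}) then (u, v) \<in> R else (v, u) \<in> R)"
  by (simp add: reoriented_def)

lemma reoriented_empty [simp]: "reoriented R C {} = R"
  by (auto simp: reoriented_def)

lemma reoriented_converse: "reoriented (R\<inverse>) (\<lambda>i. (C i)\<inverse>) I = (reoriented R C I)\<inverse>"
proof -
  have "(u, v) \<in> reoriented (R\<inverse>) (\<lambda>i. (C i)\<inverse>) I \<longleftrightarrow> (v, u) \<in> reoriented R C I" for u v
    unfolding mem_reoriented touches_converse touches_commute[of _ v u] by simp
  then show ?thesis by auto
qed

lemma short_cycle_converse: "short_cycle C \<Longrightarrow> short_cycle (C\<inverse>)"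
proof -
  have "{(a, b), (b, c), (c, a)}\<inverse> = {(a, c), (c, b), (b, a)}" for a b c :: 'a by auto
  moreover have "{(a, b), (b, c), (c, d), (d, a)}\<inverse> = {(a, d), (d, c), (c, b), (b, a)}"
    for a b c d :: 'a by auto
  moreover assume "short_cycle C"
  ultimately show ?thesis unfolding short_cycle_def
    by (elim disjE exE conjE; simp) metis+
qed

text \<open>A cycle and its converse touch the same edges, so all parities agree. This symmetry
  carries results on out-degrees over to in-degrees.\<close>

lemma reversal_run_converse:
  "reversal_run R r C \<Longrightarrow> reversal_run (R\<inverse>) r (\<lambda>i. (C i)\<inverse>)"
  unfolding reversal_run_def by (auto simp: reoriented_converse short_cycle_converse)

lemma short_cycle_dicycles:
  assumes "short_cycle C" "C \<subseteq> parcs E" "parcs E \<subseteq> pverts E \<times> pverts E"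
  shows "C \<in> dicycles E"
proof -
  from assms(1) consider
    a b c where "distinct [a, b, c]" "C = set [(a, b), (b, c), (c, a)]" |
    a b c d where "distinct [a, b, c, d]" "C = set [(a, b), (b, c), (c, d), (d, a)]"
    by (auto simp: short_cycle_def)
  then show ?thesis
  proof cases
    case 1
    then have "pre_digraph.cycle (with_proj E) [(a, b), (b, c), (c, a)]"
      using assms(2,3) unfolding pre_digraph.cycle_def
      by (intro exI[of _ a])
        (auto simp: pre_digraph.awalk_def pre_digraph.cas.simps pre_digraph.awalk_verts.simps)
    then show ?thesis using 1(2) unfolding dicycles_def by blast
  next
    case 2
    then have "pre_digraph.cycle (with_proj E) [(a, b), (b, c), (c, d), (d, a)]"
      using assms(2,3) unfolding pre_digraph.cycle_def
      by (intro exI[of _ a])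
        (auto simp: pre_digraph.awalk_def pre_digraph.cas.simps pre_digraph.awalk_verts.simps)
    then show ?thesis using 2(2) unfolding dicycles_def by blast
  qed
qed

lemma mem_reoriented_untouched:
  "{i\<in>I. touches (C i) a b} = {} \<Longrightarrow> (a, b) \<in> reoriented R C I \<longleftrightarrow> (a, b) \<in> R"
  by (simp only: mem_reoriented card.empty even_zero if_True)

text \<open>Parities add over disjoint index sets. Finiteness makes \<open>card\<close> additive
  here; on infinite sets it is 0.\<close>

lemma reoriented_Un:
  assumes "A \<inter> B = {}" "\<And>a b. finite {i\<in>A. touches (C i) a b}" "\<And>a b. finite {i\<in>B. touches (C i) a b}"
  shows "reoriented R C (A \<union> B) = reoriented (reoriented R C A) C B"
proof -
  have "(a, b) \<in> reoriented R C (A \<union> B) \<longleftrightarrow> (a, b) \<in> reoriented (reoriented R C A) C B" for a b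
  proof -
    have "{i\<in>A \<union> B. touches (C i) a b} = {i\<in>A. touches (C i) a b} \<union> {i\<in>B. touches (C i) a b}" by blast
    moreover have "card ({i\<in>A. touches (C i) a b} \<union> {i\<in>B. touches (C i) a b}) =
        card {i\<in>A. touches (C i) a b} + card {i\<in>B. touches (C i) a b}"
      using assms by (intro card_Un_disjoint) auto
    ultimately show ?thesis unfolding mem_reoriented touches_commute[of _ b a] by simp
  qed
  then show ?thesis by auto
qed

lemma reoriented_slice: "reoriented R C ({n} \<times> A) = reoriented R (\<lambda>i. C (n, i)) A"
proof -
  have "card {p \<in> {n} \<times> A. touches (C p) a b} = card {i\<in>A. touches (C (n, i)) a b}" for a b
  proof -
    have "{p \<in> {n} \<times> A. touches (C p) a b} = Pair n ` {i\<in>A. touches (C (n, i)) a b}" by auto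
    then show ?thesis by (simp add: card_image inj_on_def)
  qed
  then show ?thesis unfolding reoriented_def by simp
qed

text \<open>The size bound lets \<open>r\<close> embed onto an initial segment of
  \<open>positions D\<close>, and the cycles are carried along. Transfinite induction then yields a
  reversal sequence for every initial segment of \<open>r\<close>; the digraph that it produces is
  read off from the last cycle through each edge.\<close>

lemma reversal_run_realized:
  fixes D :: "'a pair_pre_digraph" and r :: "'i rel"
  assumes T: "tournament D" and run: "reversal_run (parcs D) r C"
    and card: "|Field r| \<le>o natLeq +c |pverts D|"
  shows "\<exists>S E. reversal D S E \<and> parcs E = reoriented (parcs D) C (Field r)"
proof -
  interpret tournament D by (rule T)
  let ?P = "positions D" and ?R = "parcs D"
  have wr: "Well_order r"
    and cyc: "\<And>i. i \<in> Field r \<Longrightarrow> short_cycle (C i) \<and> C i \<subseteq> reoriented ?R C (underS r i)"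
    and fin: "\<And>u v. finite {i\<in>Field r. touches (C i) u v}"
    using run by (auto simp: reversal_run_def)
  have wP: "Well_order ?P" by (rule positions_Well_order)
  have sub: "?R \<subseteq> pverts D \<times> pverts D" using in_arcsD1 in_arcsD2 by auto
  have asym: "(u, v) \<in> ?R \<Longrightarrow> (v, u) \<notin> ?R" for u v
    using exactly_one_arc[of u v] in_arcsD1 in_arcsD2 pair_no_loops[of "(u, v)"] by auto
  \<comment> \<open>Otherwise the successor cardinal \<open>positions D\<close> would have at most
    \<open>natLeq +c |pverts D|\<close> elements.\<close>
  have "r \<le>o ?P"
  proof (rule ccontr)
    assume "\<not> r \<le>o ?P"
    then have "?P \<le>o r" using wr wP ordLeq_total by blast
    then have "|Field ?P| \<le>o |Field r|" by (rule card_of_mono2)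
    then have "|Field ?P| \<le>o natLeq +c |pverts D|" using card ordLeq_transitive by blast
    moreover have "natLeq +c |pverts D| <o ?P"
      unfolding positions_def by (rule cardSuc_greater[OF Card_order_csum])
    moreover have "?P =o |Field ?P|"
      unfolding positions_def
      by (rule ordIso_symmetric[OF card_of_Field_ordIso[OF cardSuc_Card_order[OF Card_order_csum]]])
    ultimately show False
      using ordLess_ordIso_trans not_ordLess_ordLeq by blast
  qed
  then obtain f where emb: "embed r ?P f" unfolding ordLeq_def by blast
  have inj: "inj_on f (Field r)" using embed_inj_on[OF wr emb] .
  have fF: "f i \<in> Field ?P" if "i \<in> Field r" for i
    using embed_Field[OF emb] that by blast
  have fU: "f ` underS r i = underS ?P (f i)" if "i \<in> Field r" for i
    using embed_underS[OF wr emb that] by (simp add: bij_betw_def)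
  have fmono: "(f i, f j) \<in> ?P" if "(i, j) \<in> r" for i j
    using embed_compat[OF emb] that by (auto simp: compat_def)
  have linr: "Linear_order r" and linP: "Linear_order ?P"
    using wr wP by (auto simp: well_order_on_def)
  have usF: "underS r i \<subseteq> Field r" for i by (auto simp: underS_def Field_def)
  have tot: "(i, j) \<in> r \<or> (j, i) \<in> r" if "i \<in> Field r" "j \<in> Field r" for i j
    using linr that unfolding order_on_defs total_on_def refl_on_def by metis
  have antiP: "antisym ?P" and antir: "antisym r" and transr: "trans r" and reflr: "Refl r"
    using linr linP by (auto simp: order_on_defs)
  have frefl: "(j, i) \<in> r" if "(f j, f i) \<in> ?P" "i \<in> Field r" "j \<in> Field r" for i j
  proof (rule ccontr)
    assume "(j, i) \<notin> r"
    then have "(i, j) \<in> r" using tot that by blast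
    then have "f i = f j" using fmono that(1) antiP by (metis antisymD)
    then have "i = j" using inj that by (simp add: inj_on_def)
    then show False using \<open>(i, j) \<in> r\<close> \<open>(j, i) \<notin> r\<close> by simp
  qed
  define g where "g = inv_into (Field r) f"
  have gf [simp]: "g (f i) = i" if "i \<in> Field r" for i
    unfolding g_def using inj that by simp
  define S where "S I = (\<lambda>p. if p \<in> f ` I then Some (C (g p)) else None)" for I
  have S_f: "S I (f i) = Some (C i)" if "i \<in> I" "I \<subseteq> Field r" for I i
    using that by (auto simp: S_def)
  have dom: "dom (S I) = f ` I" for I by (auto simp: S_def split: if_splits)
  have through: "cycles_through (S I) u v = f ` {i\<in>I. touches (C i) u v}" if "I \<subseteq> Field r" for I u v
  proof -
    have "p \<in> cycles_through (S I) u v \<longleftrightarrow> p \<in> f ` I \<and> touches (C (g p)) u v" for p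
      by (simp add: cycles_through_def S_def touches_def)
    moreover have "p \<in> f ` {i\<in>I. touches (C i) u v} \<longleftrightarrow> p \<in> f ` I \<and> touches (C (g p)) u v" for p
      using that by auto
    ultimately show ?thesis by blast
  qed
  \<comment> \<open>By \<open>reversal_char\<close> the last cycle \<open>C i\<close> through an
    edge decides its direction. It lies in the state left by the indices below \<open>i\<close>, and
    \<open>i\<close> itself raises the count by one, so the parity rule gives the same
    direction.\<close>
  have state: "parcs E = reoriented ?R C I"
    if I: "I \<subseteq> Field r" "\<forall>i\<in>I. underS r i \<subseteq> I" and E: "reversal D (S I) E" for I E
  proof -
    note ch = reversal_char[OF E]
    have "(u, v) \<in> parcs E \<longleftrightarrow> (u, v) \<in> reoriented ?R C I" for u v
    proof (cases "{i\<in>I. touches (C i) u v} = {}")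
      case True
      then have "cycles_through (S I) u v = {}" using through[OF I(1)] by blast
      then show ?thesis unfolding reoriented_def mem_Collect_eq prod.case True using ch by simp
    next
      case False
      then have ne: "cycles_through (S I) u v \<noteq> {}" using through[OF I(1)] by blast
      have "finite (cycles_through (S I) u v)" using ch by (simp add: locally_finite_def)
      then obtain p where p: "last_through D (S I) u v p"
        using ex_last_through[OF _ ne] ch by blast
      then obtain i where i: "p = f i" "i \<in> I" "touches (C i) u v"
        using through[OF I(1)] by (auto simp: last_through_def)
      have iF: "i \<in> Field r" using i I by blast
      have le: "(j, i) \<in> r" if "j \<in> I" "touches (C j) u v" for j
      proof -
        have "f j \<in> cycles_through (S I) u v" using that through[OF I(1)] by blast
        then have "(f j, f i) \<in> ?P" using p i(1) by (simp add: last_through_def)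
        then show ?thesis using frefl iF that I by blast
      qed
      have "{j\<in>I. touches (C j) u v} = insert i {j\<in>underS r i. touches (C j) u v}"
        using le i I(2) by (auto simp: underS_def)
      moreover have "finite {j\<in>underS r i. touches (C j) u v}"
        using I i by (intro finite_subset[OF _ fin[of u v]]) blast
      moreover have "i \<notin> {j\<in>underS r i. touches (C j) u v}" by (simp add: underS_def)
      ultimately have cd: "card {j\<in>I. touches (C j) u v} = Suc (card {j\<in>underS r i. touches (C j) u v})"
        by simp
      have "(u, v) \<in> parcs E \<longleftrightarrow> (v, u) \<in> C i"
        using ch p i S_f[OF i(2) I(1)] by auto
      moreover have "(v, u) \<in> C i \<longleftrightarrow> (u, v) \<in> reoriented ?R C I"
      proof
        assume "(v, u) \<in> C i"
        then have "(v, u) \<in> reoriented ?R C (underS r i)" using cyc[OF iF] by blast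
        then show "(u, v) \<in> reoriented ?R C I"
          unfolding mem_reoriented touches_commute[of _ v u] cd by (simp split: if_splits)
      next
        assume uv: "(u, v) \<in> reoriented ?R C I"
        show "(v, u) \<in> C i"
        proof (rule ccontr)
          assume "(v, u) \<notin> C i"
          then have "(u, v) \<in> C i" using i(3) by (simp add: touches_def)
          then have "(u, v) \<in> reoriented ?R C (underS r i)" using cyc[OF iF] by blast
          then show False
            using uv asym unfolding mem_reoriented cd by (simp split: if_splits)
        qed
      qed
      ultimately show ?thesis by blast
    qed
    then show ?thesis by auto
  qed
  have sub': "reoriented ?R C I \<subseteq> pverts D \<times> pverts D" for I
    using sub by (auto simp: reoriented_def split: if_splits)
  \<comment> \<open>An initial segment is empty, has a greatest index, or is nonempty without one;
    these cases match the three rules of \<open>reversal\<close>.\<close>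
  have step: "\<exists>E. reversal D (S I) E"
    if I: "I \<subseteq> Field r" "\<forall>i\<in>I. underS r i \<subseteq> I" and
      ih: "\<forall>i\<in>I. \<exists>E. reversal D (S (underS r i)) E" for I
  proof -
    consider "I = {}" | i where "i \<in> I" "\<forall>j\<in>I. (j, i) \<in> r"
      | "I \<noteq> {}" "\<forall>i\<in>I. \<exists>j\<in>I. (j, i) \<notin> r" by blast
    then show ?thesis
    proof cases
      case 1
      then have "S I = Map.empty" by (auto simp: S_def)
      then show ?thesis using reversal.empty by metis
    next
      case (2 i)
      have iF: "i \<in> Field r" using 2 I by blast
      have us: "underS r i \<subseteq> Field r" by (rule usF)
      have Ieq: "I = insert i (underS r i)" using 2 I(2) by (auto simp: underS_def)
      obtain E where E: "reversal D (S (underS r i)) E" using ih 2 by blast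
      have dc: "\<forall>j\<in>underS r i. underS r j \<subseteq> underS r i"
        using transr antir by (auto simp: underS_def dest: transD antisymD)
      have pE: "parcs E = reoriented ?R C (underS r i)" using state[OF us dc E] .
      have "pverts E = pverts D" using reversal_char[OF E] by blast
      then have "C i \<in> dicycles E"
        using cyc[OF iF] sub' pE by (intro short_cycle_dicycles) auto
      then have "reversal D ((S (underS r i))(f i \<mapsto> C i)) (reverse_cycle E (C i))"
        using reversal.snoc[OF E fF[OF iF]] fU[OF iF] dom by simp
      moreover have "(S (underS r i))(f i \<mapsto> C i) = S I"
      proof
        fix p
        show "((S (underS r i))(f i \<mapsto> C i)) p = S I p"
          using iF by (cases "p = f i") (auto simp: S_def Ieq)
      qed
      ultimately show ?thesis by auto
    next
      case 3
      \<comment> \<open>The limit rule takes its index order on positions, so the image of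
        \<open>I\<close> replaces \<open>I\<close>; the stage at \<open>\<xi>\<close> is the
        sequence below the index \<open>g \<xi>\<close>.\<close>
      let ?z = "Restr ?P (f ` I)"
      have reflP: "Refl ?P" using linP by (auto simp: order_on_defs)
      have Fz: "Field ?z = f ` I"
      proof
        show "Field ?z \<subseteq> f ` I" by (auto simp: Field_def)
        show "f ` I \<subseteq> Field ?z"
        proof
          fix p assume p: "p \<in> f ` I"
          then have "p \<in> Field ?P" using I fF by blast
          then have "(p, p) \<in> ?z" using p reflP by (auto simp: refl_on_def)
          then show "p \<in> Field ?z" by (rule FieldI1)
        qed
      qed
      obtain E where E: "\<And>i. i \<in> I \<Longrightarrow> reversal D (S (underS r i)) (E i)"
        using ih by metis
      have gI: "g p \<in> I" "f (g p) = p" if "p \<in> f ` I" for p using that I by auto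
      have above: "\<exists>j\<in>I. (i, j) \<in> r \<and> i \<noteq> j" if "i \<in> I" for i
      proof -
        obtain j where j: "j \<in> I" "(j, i) \<notin> r" using 3 \<open>i \<in> I\<close> by blast
        then have "(i, j) \<in> r" using tot[of i j] \<open>i \<in> I\<close> I by blast
        then show ?thesis using j by auto
      qed
      have S_U: "S I p = Some c \<longleftrightarrow> (\<exists>\<xi>\<in>f ` I. S (underS r (g \<xi>)) p = Some c)" for p c
      proof
        assume "S I p = Some c"
        then obtain i where i: "i \<in> I" "p = f i" "c = C i"
          using I by (auto simp: S_def split: if_splits)
        \<comment> \<open>As \<open>underS\<close> is strict, the cycle of \<open>i\<close> occurs
          only in stages strictly above \<open>i\<close>.\<close>
        obtain j where j: "j \<in> I" "(i, j) \<in> r" "i \<noteq> j" using above i by blast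
        then have "i \<in> underS r (g (f j))" using I by (auto simp: underS_def)
        then have "S (underS r (g (f j))) p = Some c"
          using i S_f[of i "underS r (g (f j))"] usF by auto
        then show "\<exists>\<xi>\<in>f ` I. S (underS r (g \<xi>)) p = Some c" using j by blast
      next
        assume "\<exists>\<xi>\<in>f ` I. S (underS r (g \<xi>)) p = Some c"
        then obtain i where "i \<in> I" "S (underS r i) p = Some c" using I by auto
        then show "S I p = Some c" using I(2) by (auto simp: S_def split: if_splits)
      qed
      have "reversal D (S I)
        (D\<lparr>parcs := {(u, v). \<exists>\<nu>\<in>Field ?z. \<forall>\<xi>\<in>aboveS ?z \<nu>. (u, v) \<in> parcs (E (g \<xi>))}\<rparr>)"
      proof (rule reversal.limit[where S = "\<lambda>\<xi>. S (underS r (g \<xi>))"])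
        show "Well_order ?z" using wP by (rule Well_order_Restr)
        show "Field ?z \<noteq> {}" using Fz 3 by simp
        show "\<forall>\<xi>\<in>Field ?z. aboveS ?z \<xi> \<noteq> {}"
        proof
          fix \<xi> assume "\<xi> \<in> Field ?z"
          then obtain i where i: "i \<in> I" "\<xi> = f i" using Fz by blast
          then obtain j where j: "j \<in> I" "(i, j) \<in> r" "i \<noteq> j" using above by blast
          then have "f i \<noteq> f j" using inj i I by (auto simp: inj_on_def)
          then have "f j \<in> aboveS ?z \<xi>" using i j fmono by (auto simp: aboveS_def)
          then show "aboveS ?z \<xi> \<noteq> {}" by blast
        qed
        show "\<forall>\<xi>\<in>Field ?z. reversal D (S (underS r (g \<xi>))) (E (g \<xi>))"
        proof
          fix \<xi> assume "\<xi> \<in> Field ?z"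
          then have "g \<xi> \<in> I" unfolding Fz by (rule gI(1))
          then show "reversal D (S (underS r (g \<xi>))) (E (g \<xi>))" by (rule E)
        qed
        show "\<forall>\<xi> \<eta>. (\<xi>, \<eta>) \<in> ?z \<longrightarrow> S (underS r (g \<xi>)) \<subseteq>\<^sub>m S (underS r (g \<eta>))"
        proof (intro allI impI)
          fix \<xi> \<eta> assume "(\<xi>, \<eta>) \<in> ?z"
          then obtain i j where ij: "i \<in> I" "j \<in> I" "\<xi> = f i" "\<eta> = f j" "(f i, f j) \<in> ?P" by auto
          then have "(i, j) \<in> r" using frefl I by blast
          then have "underS r i \<subseteq> underS r j"
            using transr antir by (auto simp: underS_def dest: transD antisymD)
          moreover have "g \<xi> = i" "g \<eta> = j" using ij I by auto
          ultimately show "S (underS r (g \<xi>)) \<subseteq>\<^sub>m S (underS r (g \<eta>))"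
            by (auto simp: map_le_def S_def)
        qed
        show "Map.graph (S I) = (\<Union>\<xi>\<in>Field ?z. Map.graph (S (underS r (g \<xi>))))"
          unfolding Fz Map.graph_def using S_U by auto
        show "locally_finite (S I)"
          unfolding locally_finite_def through[OF I(1)]
          by (intro allI finite_imageI finite_subset[OF _ fin]) (use I in auto)
      qed
      then show ?thesis by blast
    qed
  qed
  have wf: "wf (r - Id)" using wr by (auto simp: well_order_on_def)
  have "i \<in> Field r \<longrightarrow> (\<exists>E. reversal D (S (underS r i)) E)" for i
  proof (induction i rule: wf_induct_rule[OF wf])
    case (1 i)
    show ?case
    proof (intro impI step)
      show "underS r i \<subseteq> Field r" by (rule usF)
      show "\<forall>j\<in>underS r i. underS r j \<subseteq> underS r i"
        using transr antir by (auto simp: underS_def dest: transD antisymD)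
      show "\<forall>j\<in>underS r i. \<exists>E. reversal D (S (underS r j)) E"
        using 1 by (auto simp: underS_def Field_def)
    qed
  qed
  then obtain E where "reversal D (S (Field r)) E"
    using step[of "Field r"] usF by blast
  then show ?thesis using state[of "Field r" E] usF by blast
qed

section \<open>Runs composed of blocks of length \<open>\<omega>\<close>\<close>

definition block_order :: "'b set \<Rightarrow> 'b rel \<Rightarrow> ('b \<times> nat) rel" where
  "block_order I s = {((i, m), (j, n)). i \<in> I \<and> j \<in> I \<and> ((i, j) \<in> s \<or> i = j \<and> m \<le> n)}"

lemma Field_block_order: "Field (block_order I s) = I \<times> UNIV"
  unfolding Field_def block_order_def by auto

lemma underS_block_order:
  assumes "wf s" "i \<in> I"
  shows "underS (block_order I s) (i, n) = {j\<in>I. (j, i) \<in> s} \<times> UNIV \<union> {i} \<times> {..<n}"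
  using assms unfolding underS_def block_order_def by auto

lemma Well_order_block_order:
  assumes s: "wf s" "trans s" "total_on I s"
  shows "Well_order (block_order I s)"
proof -
  let ?b = "block_order I s"
  have irr: "(i, i) \<notin> s" for i using s(1) by simp
  have asym: "(i, j) \<in> s \<Longrightarrow> (j, i) \<notin> s" for i j using s(1) by (meson wf_asym)
  have "refl_on (Field ?b) ?b"
    unfolding refl_on_def Field_block_order by (auto simp: block_order_def)
  moreover have "?b \<subseteq> Field ?b \<times> Field ?b" unfolding Field_block_order by (auto simp: block_order_def)
  moreover have "trans ?b"
    using s(2) by (auto simp: trans_def block_order_def)
  moreover have "antisym ?b"
    using irr asym by (auto simp: antisym_def block_order_def)
  moreover have "total_on (Field ?b) ?b"
    using s(3) unfolding Field_block_order total_on_def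
    by (auto simp: block_order_def)
  moreover have "wf (?b - Id)"
    by (rule wf_subset[OF wf_lex_prod[OF s(1) wf_less_than]]) (auto simp: block_order_def)
  ultimately show ?thesis
    by (simp add: well_order_on_def linear_order_on_def partial_order_on_def preorder_on_def)
qed

text \<open>Before cycle \<open>n\<close> of block \<open>i\<close>, all blocks preceding
  \<open>i\<close> are complete and \<open>n\<close> cycles of block \<open>i\<close> are done.
  Later proofs only have to examine this state.\<close>

lemma block_run:
  assumes s: "wf s" "trans s" "total_on I s"
    and cyc: "\<And>i n. i \<in> I \<Longrightarrow> short_cycle (C (i, n))"
    and sub: "\<And>i n. i \<in> I \<Longrightarrow>
      C (i, n) \<subseteq> reoriented R C ({j\<in>I. (j, i) \<in> s} \<times> UNIV \<union> {i} \<times> {..<n})"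
    and fin: "\<And>u v. finite {p \<in> I \<times> UNIV. touches (C p) u v}"
  shows "reversal_run R (block_order I s) C"
proof -
  have "C p \<subseteq> reoriented R C (underS (block_order I s) p)" if "p \<in> I \<times> UNIV" for p
    using sub[of "fst p" "snd p"] underS_block_order[OF s(1), of "fst p" I "snd p"] that by auto
  then show ?thesis
    unfolding reversal_run_def Field_block_order
    using Well_order_block_order[OF s] cyc fin by (auto simp: Field_block_order)
qed

text \<open>Two index types, because the countable case uses countably many blocks of reversals and the
  singular case one block for each arc to be turned around.\<close>

definition reorients :: "'a set \<Rightarrow> 'a rel \<Rightarrow> 'a rel \<Rightarrow> bool" where
  "reorients V R R' \<longleftrightarrow>
     (\<exists>(r :: (nat \<times> nat) rel) C. reversal_run R r C \<and> R' = reoriented R C (Field r)) \<or>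
     (\<exists>(r :: (('a \<times> 'a) \<times> nat) rel) C. Field r \<subseteq> (V \<times> V) \<times> UNIV \<and>
        reversal_run R r C \<and> R' = reoriented R C (Field r))"

lemma reorients_refl: "reorients V R R"
  unfolding reorients_def reversal_run_def
  by (intro disjI1 exI[of _ "{}"] exI[of _ undefined]) (simp add: Field_def)

lemma reorients_converse:
  assumes "reorients V R R'"
  shows "reorients V (R\<inverse>) (R'\<inverse>)"
  using assms unfolding reorients_def
  by (elim disjE exE conjE)
    (metis reoriented_converse reversal_run_converse)+

section \<open>Cofinality\<close>

lemma finite_card_ordLess: "finite A \<Longrightarrow> infinite B \<Longrightarrow> |A| <o |B|"
  using finite_ordLess_infinite[OF card_of_Well_order card_of_Well_order, of A B]
  by (simp add: Field_card_of)

lemma Well_order_total: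
  "Well_order r \<Longrightarrow> a \<in> Field r \<Longrightarrow> b \<in> Field r \<Longrightarrow> a \<noteq> b \<Longrightarrow> (a, b) \<in> r \<or> (b, a) \<in> r"
  unfolding well_order_on_def linear_order_on_def total_on_def by blast

text \<open>A well-order strictly below \<open>k\<close> is isomorphic to a proper initial segment
  of \<open>k\<close>. Thus size bounds become elements of \<open>Field k\<close>, where they can be
  compared.\<close>

lemma ordLess_card_underS:
  assumes "Card_order k" "|X| <o k"
  shows "\<exists>a\<in>Field k. |X| \<le>o |underS k a|"
proof -
  have "Well_order k" using assms(1) by (simp add: card_order_on_def)
  then obtain a where a: "a \<in> Field k" "|X| =o Restr k (underS k a)"
    using ordLess_iff_ordIso_Restr[OF _ card_of_Well_order] assms(2) by blast
  have "|Field |X| | \<le>o |Field (Restr k (underS k a))|"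
    using a(2) by (intro card_of_mono2 ordIso_imp_ordLeq)
  moreover have "|Field (Restr k (underS k a))| \<le>o |underS k a|"
    by (intro card_of_mono1) (auto simp: Field_def)
  ultimately have "|X| \<le>o |underS k a|" using ordLeq_transitive by (simp add: Field_card_of) blast
  then show ?thesis using a(1) by blast
qed

lemma cofinality_ordLeq:
  assumes "Card_order k" "infinite (Field k)"
  shows "cofinality k \<le>o k"
proof -
  obtain A where A: "A \<subseteq> Field k" "cofinality k = |A|" using cofinality_exists[OF assms] by blast
  then have "|A| \<le>o |Field k|" by (intro card_of_mono1)
  then show ?thesis using A card_of_Field_ordIso[OF assms(1)] ordLeq_ordIso_trans by metis
qed

lemma ordLess_cofinality_bounded:
  assumes k: "Card_order k" "infinite (Field k)" and K: "K \<subseteq> Field k" "|K| <o cofinality k"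
  shows "\<exists>a\<in>Field k. \<forall>b\<in>K. (b, a) \<in> k"
proof -
  obtain A where A: "cofinality k = |A|" "\<forall>B. B \<subseteq> Field k \<and> cofinal B k \<longrightarrow> |A| \<le>o |B|"
    using cofinality_exists[OF k] by blast
  have "\<not> cofinal K k"
    using A K not_ordLess_ordLeq by metis
  then obtain a where a: "a \<in> Field k" "\<forall>b\<in>K. \<not> (a \<noteq> b \<and> (a, b) \<in> k)"
    by (auto simp: cofinal_def)
  have "Well_order k" using k(1) by (simp add: card_order_on_def)
  then have "Refl k" "total_on (Field k) k" by (auto simp: order_on_defs)
  then have "\<forall>b\<in>K. (b, a) \<in> k"
    using a K(1) unfolding refl_on_def total_on_def by (metis subsetD)
  then show ?thesis using a(1) by blast
qed

text \<open>The sizes of the members are bounded by fewer than \<open>cofinality k\<close> elements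
  of \<open>k\<close>, and these have a common upper bound in \<open>k\<close>.\<close>

lemma card_UN_ordLess_cofinality:
  assumes k: "Card_order k" "infinite (Field k)"
    and I: "|I| <o cofinality k" and X: "\<forall>i\<in>I. |X i| <o k"
  shows "|\<Union>i\<in>I. X i| <o k"
proof -
  have "\<forall>i\<in>I. \<exists>a. a \<in> Field k \<and> |X i| \<le>o |underS k a|"
    using ordLess_card_underS[OF k(1)] X by blast
  from bchoice[OF this] obtain f where f: "\<forall>i\<in>I. f i \<in> Field k \<and> |X i| \<le>o |underS k (f i)|"
    by blast
  have "|f ` I| <o cofinality k" using card_of_image I ordLeq_ordLess_trans by blast
  moreover have "f ` I \<subseteq> Field k" using f by blast
  ultimately obtain a where a: "a \<in> Field k" "\<forall>b\<in>f ` I. (b, a) \<in> k"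
    using ordLess_cofinality_bounded[OF k] by blast
  \<comment> \<open>One set below \<open>k\<close> that bounds the index set and every member at
    once.\<close>
  let ?B = "I <+> underS k a"
  have "Well_order k" using k(1) by (simp add: card_order_on_def)
  then have tr: "trans k" "antisym k" by (auto simp: order_on_defs)
  have leB: "|X i| \<le>o |?B|" if "i \<in> I" for i
  proof -
    have "underS k (f i) \<subseteq> underS k a"
      using a(2) that tr by (auto simp: underS_def dest: transD antisymD)
    then have 1: "|underS k (f i)| \<le>o |underS k a|" by (rule card_of_mono1)
    have 2: "|underS k a| \<le>o |?B|" by (rule card_of_Plus2)
    have "|X i| \<le>o |underS k (f i)|" using f that by blast
    then show ?thesis using ordLeq_transitive[OF _ ordLeq_transitive[OF 1 2]] by blast
  qed
  have "|I| <o k" using I cofinality_ordLeq[OF k] ordLess_ordLeq_trans by blast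
  then have B: "|?B| <o k"
    using card_of_Plus_ordLess_infinite_Field[OF k(2,1)] card_of_underS[OF k(1) a(1)] by blast
  \<comment> \<open>The union bound requires an infinite \<open>?B\<close>; for finite
    \<open>?B\<close> the union is finite, hence smaller than the infinite \<open>k\<close>.\<close>
  show ?thesis
  proof (cases "finite ?B")
    case True
    then have "finite I" by (simp add: finite_Plus_iff)
    moreover have "\<forall>i\<in>I. finite (X i)" using leB True card_of_ordLeq_finite by blast
    ultimately have "finite (\<Union>i\<in>I. X i)" by blast
    then show ?thesis
      using finite_ordLess_infinite[OF card_of_Well_order \<open>Well_order k\<close>] k(2)
      by (simp add: Field_card_of)
  next
    case False
    then have "|\<Union>i\<in>I. X i| \<le>o |?B|"
      using leB card_of_Plus1 by (intro card_of_UNION_ordLeq_infinite) auto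
    then show ?thesis using B ordLeq_ordLess_trans by blast
  qed
qed

text \<open>Every set \<open>W \<xi>\<close> is dominated by its complement, so these sets form a chain, and the
  least \<open>\<xi>\<close> with \<open>v \<in> W \<xi>\<close> ranks the vertices. The ranks that occur have the order type of the
  cofinality, as fewer sets of size below \<open>k\<close> do not cover \<open>V\<close>.\<close>

lemma ordered_partition_of_dominated_sets:
  fixes k m :: "'k rel"
  assumes k: "Card_order k" "infinite (Field k)" and V: "|V| =o k" and m: "m = cofinality k"
    and W: "\<And>\<xi>. \<xi> \<in> Field m \<Longrightarrow> |W \<xi>| <o k" and cover: "V \<subseteq> (\<Union>\<xi>\<in>Field m. W \<xi>)"
    and dom: "\<And>\<xi> u v. \<xi> \<in> Field m \<Longrightarrow> u \<in> V - W \<xi> \<Longrightarrow> v \<in> V \<inter> W \<xi> \<Longrightarrow> (u, v) \<in> R"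
  shows "\<exists>P. partition_on V (P ` Field m) \<and> disjoint_family_on P (Field m) \<and>
    (\<forall>\<xi>\<in>Field m. |P \<xi>| <o k) \<and>
    (\<forall>\<xi>\<in>Field m. \<forall>\<zeta>\<in>underS m \<xi>. \<forall>u\<in>P \<xi>. \<forall>v\<in>P \<zeta>. (u, v) \<in> R)"
proof -
  obtain A where A: "m = |A|" using cofinality_exists[OF k] m by blast
  have Cm: "Card_order m" using A card_of_Card_order by blast
  have wm: "Well_order m" using Cm by (simp add: card_order_on_def)
  then have wf: "wf (m - Id)" by (simp add: well_order_on_def)
  have "\<exists>\<xi>\<in>Field m. v \<in> W \<xi> \<and> (\<forall>\<eta>\<in>underS m \<xi>. v \<notin> W \<eta>)" if v: "v \<in> V" for v
  proof -
    obtain z where "z \<in> {\<xi>\<in>Field m. v \<in> W \<xi>}" using cover v by blast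
    from wfE_min[OF wf this] obtain \<xi>
      where "\<xi> \<in> {\<xi>\<in>Field m. v \<in> W \<xi>}" "\<And>\<eta>. (\<eta>, \<xi>) \<in> m - Id \<Longrightarrow> \<eta> \<notin> {\<xi>\<in>Field m. v \<in> W \<xi>}" by blast
    then show ?thesis by (intro bexI[of _ \<xi>]) (auto simp: underS_def Field_def)
  qed
  then obtain l where l: "\<And>v. v \<in> V \<Longrightarrow> l v \<in> Field m \<and> v \<in> W (l v) \<and> (\<forall>\<eta>\<in>underS m (l v). v \<notin> W \<eta>)"
    by metis
  let ?I = "l ` V" and ?s = "Restr m (l ` V)"
  have IF: "?I \<subseteq> Field m" using l by blast
  \<comment> \<open>With fewer than \<open>cofinality k\<close> ranks, \<open>V\<close> would be a
    union of too few small sets.\<close>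
  have "\<not> |?I| <o m"
  proof
    assume "|?I| <o m"
    then have "|\<Union>i\<in>?I. W i| <o k"
      using card_UN_ordLess_cofinality[OF k] W IF m by blast
    moreover have "|V| \<le>o |\<Union>i\<in>?I. W i|" using l by (intro card_of_mono1) blast
    ultimately have "|V| <o k" using ordLeq_ordLess_trans by blast
    then show False using V not_ordLess_ordIso by blast
  qed
  then have "m \<le>o |?I|"
    using wm card_of_Well_order[of ?I] by (simp add: not_ordLess_iff_ordLeq)
  moreover have ws: "Well_order ?s" using wm by (rule Well_order_Restr)
  moreover have Fs: "Field ?s = ?I"
  proof -
    have "Refl m" using wm by (simp add: order_on_defs)
    then have "(i, i) \<in> ?s" if "i \<in> ?I" for i using IF that by (auto simp: refl_on_def)
    then show ?thesis unfolding Field_def by blast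
  qed
  \<comment> \<open>A cardinal lies below every well-order on the same set, here below the order
    that the ranks inherit from \<open>m\<close>.\<close>
  then have "|?I| \<le>o ?s" using ws card_of_least by metis
  ultimately have "m \<le>o ?s" using ordLeq_transitive by blast
  then obtain g where g: "embed m ?s g" unfolding ordLeq_def by blast
  have inj: "inj_on g (Field m)" by (rule embed_inj_on[OF wm g])
  \<comment> \<open>If the embedding were not onto, its image would lie strictly below some rank
    \<open>i\<close>; but fewer than \<open>m\<close> elements precede \<open>i\<close> in the
    cardinal \<open>m\<close>.\<close>
  have gI: "g ` Field m = ?I"
  proof (rule ccontr)
    assume "g ` Field m \<noteq> ?I"
    moreover have "ofilter ?s (g ` Field m)" by (rule embed_Field_ofilter[OF wm ws g])
    ultimately obtain i where i: "i \<in> ?I" "g ` Field m = underS ?s i"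
      using wo_rel.ofilter_underS_Field[of ?s] ws Fs by (auto simp: wo_rel_def)
    have "|Field m| \<le>o |underS m i|"
      using inj i by (intro card_of_ordLeqI[of g]) (auto simp: underS_def)
    moreover have "|underS m i| <o m" using card_of_underS[OF Cm] i IF by blast
    ultimately have "|Field m| <o m" using ordLeq_ordLess_trans by blast
    then show False using card_of_Field_ordIso[OF Cm] not_ordLess_ordIso by blast
  qed
  define P where "P \<xi> = {v \<in> V. l v = g \<xi>}" for \<xi>
  have "partition_on V (P ` Field m)"
  proof (rule partition_onI)
    show "\<Union> (P ` Field m) = V" using gI by (auto simp: P_def)
    have "P \<xi> \<noteq> {}" if "\<xi> \<in> Field m" for \<xi>
    proof -
      have "g \<xi> \<in> l ` V" using gI that by blast
      then obtain v where "v \<in> V" "l v = g \<xi>" by auto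
      then show ?thesis by (auto simp: P_def)
    qed
    then show "{} \<notin> P ` Field m" by blast
    show "disjnt p q" if "p \<in> P ` Field m" "q \<in> P ` Field m" "p \<noteq> q" for p q
      using that by (auto simp: P_def disjnt_def)
  qed
  moreover have "disjoint_family_on P (Field m)"
    using inj by (auto simp: disjoint_family_on_def P_def inj_on_def)
  moreover have "|P \<xi>| <o k" if x: "\<xi> \<in> Field m" for \<xi>
  proof -
    have gF: "g \<xi> \<in> Field m" using x gI IF by blast
    have "v \<in> W (g \<xi>)" if "v \<in> P \<xi>" for v using l[of v] that by (simp add: P_def)
    then have "|P \<xi>| \<le>o |W (g \<xi>)|" by (intro card_of_mono1) blast
    then show ?thesis using W[OF gF] by (rule ordLeq_ordLess_trans)
  qed
  moreover have "(u, v) \<in> R"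
    if x: "\<xi> \<in> Field m" "\<zeta> \<in> underS m \<xi>" and uv: "u \<in> P \<xi>" "v \<in> P \<zeta>" for \<xi> \<zeta> u v
  proof -
    have "\<zeta> \<in> Field m" using x(2) by (auto simp: underS_def Field_def)
    then have gz: "g \<zeta> \<in> Field m" using gI IF by blast
    have "g \<zeta> \<in> underS ?s (g \<xi>)"
      using embed_underS[OF wm g x(1)] x(2) by (auto simp: bij_betw_def)
    then have "g \<zeta> \<in> underS m (g \<xi>)" by (auto simp: underS_def)
    \<comment> \<open>The rank of \<open>u\<close> is \<open>g \<xi>\<close>, the least index of a
      set containing \<open>u\<close>, and \<open>g \<zeta>\<close> is smaller.\<close>
    then have "u \<notin> W (g \<zeta>)" "v \<in> W (g \<zeta>)" "u \<in> V" "v \<in> V"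
      using uv l[of u] l[of v] by (auto simp: P_def)
    then show ?thesis using dom[OF gz, of u v] by blast
  qed
  ultimately show ?thesis by (intro exI[of _ P]) blast
qed

text \<open>Successors of infinite cardinals are regular, so a singular cardinal cannot be one of
  them.\<close>

lemma cardSuc_ordLess_not_regularCard:
  assumes k: "Card_order k" "\<not> regularCard k" and c: "Card_order c" "infinite (Field c)" "c <o k"
  shows "cardSuc c <o k"
proof (rule ccontr)
  assume no: "\<not> cardSuc c <o k"
  have cs: "Card_order (cardSuc c)" by (rule cardSuc_Card_order[OF c(1)])
  have "cardSuc c \<le>o k" by (rule cardSuc_least[OF c(1) k(1) c(3)])
  then have iso: "cardSuc c =o k" using no ordLeq_iff_ordLess_or_ordIso by blast
  have "Cinfinite (cardSuc c)" using c by (intro Cinfinite_cardSuc) (simp add: cinfinite_def)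
  moreover have "regularCard (cardSuc c)" by (rule infinite_cardSuc_regularCard[OF c(2,1)])
  ultimately have "regularCard k" using regularCard_ordIso[OF iso] by blast
  then show False using k(2) by blast
qed

lemma regularCard_cofinality:
  assumes k: "Card_order k" "infinite (Field k)" and reg: "regularCard k"
  shows "cofinality k =o k"
proof -
  obtain A where "A \<subseteq> Field k" "cofinal A k" "cofinality k = |A|" using cofinality_exists[OF k] by blast
  then show ?thesis using reg by (simp add: regularCard_def)
qed

lemma card_of_surj_ordIso:
  assumes "|A| =o |B|" "A \<noteq> {}"
  shows "\<exists>g. g ` B = A"
  using card_of_ordLeq2[OF assms(2), of B] ordIso_imp_ordLeq[OF assms(1)] by blast

section \<open>Turning around the arcs towards vertices of larger out-degree\<close>

definition tournament_on :: "'a set \<Rightarrow> 'a rel \<Rightarrow> bool" where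
  "tournament_on V R \<longleftrightarrow> R \<subseteq> V \<times> V \<and> asym R \<and> total_on V R"

lemma tournament_onD:
  assumes "tournament_on V R"
  shows "(u, v) \<in> R \<Longrightarrow> u \<in> V" "(u, v) \<in> R \<Longrightarrow> v \<in> V" "(u, v) \<in> R \<Longrightarrow> u \<noteq> v"
    "(u, v) \<in> R \<Longrightarrow> (v, u) \<notin> R" "u \<in> V \<Longrightarrow> v \<in> V \<Longrightarrow> u \<noteq> v \<Longrightarrow> (u, v) \<notin> R \<Longrightarrow> (v, u) \<in> R"
  using assms by (auto simp: tournament_on_def total_on_def dest: asymD)

lemma tournament_on_converse: "tournament_on V R \<Longrightarrow> tournament_on V (R\<inverse>)"
  by (auto simp: tournament_on_def)

text \<open>A larger \<open>X\<close> would contain a set \<open>?Y\<close> of size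
  \<open>c\<close>. This set and its out-neighbours do not exhaust \<open>X\<close>, and a vertex of
  \<open>X\<close> left over dominates all of \<open>?Y\<close>, so its out-degree is at least
  \<open>c\<close>.\<close>

lemma card_small_outdegrees:
  assumes T: "tournament_on V R" and c: "Card_order c" "infinite (Field c)"
    and X: "X \<subseteq> V" "\<forall>x\<in>X. |R `` {x}| <o c"
  shows "|X| \<le>o c"
proof (rule ccontr)
  have wc: "Well_order c" using c(1) by (simp add: card_order_on_def)
  assume "\<not> |X| \<le>o c"
  then have lt: "c <o |X|" using wc card_of_Well_order[of X] by (simp add: not_ordLeq_iff_ordLess)
  have cF: "|Field c| =o c" by (rule card_of_Field_ordIso[OF c(1)])
  then have "|Field c| \<le>o |X|" using lt ordIso_ordLess_trans ordLess_imp_ordLeq by blast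
  then obtain f where f: "inj_on f (Field c)" "f ` Field c \<subseteq> X" using card_of_ordLeq by metis
  let ?Y = "f ` Field c"
  have "|?Y| \<le>o |Field c|" by (rule card_of_image)
  then have Y: "|?Y| \<le>o c" using cF ordLeq_ordIso_trans by blast
  have "|\<Union>y\<in>?Y. R `` {y}| \<le>o c"
    using Y X f(2) ordLess_imp_ordLeq by (intro card_of_UNION_ordLeq_infinite_Field[OF c(2,1)]) blast+
  then have "|?Y \<union> (\<Union>y\<in>?Y. R `` {y})| \<le>o c"
    using Y c by (intro card_of_Un_ordLeq_infinite_Field) auto
  then have "\<not> X \<subseteq> ?Y \<union> (\<Union>y\<in>?Y. R `` {y})"
    using card_of_mono1 lt not_ordLess_ordLeq ordLeq_transitive by metis
  then obtain z where z: "z \<in> X" "z \<notin> ?Y" "\<forall>y\<in>?Y. (y, z) \<notin> R" by blast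
  then have "?Y \<subseteq> R `` {z}" 
  proof -
    have "(z, y) \<in> R" if y: "y \<in> ?Y" for y
      using tournament_onD(5)[OF T, of y z] X(1) f(2) y z by blast
    then show ?thesis by blast
  qed
  then have "|Field c| \<le>o |R `` {z}|" using f(1) by (intro card_of_ordLeqI[of f]) auto
  then have "|Field c| <o c" using X(2) z(1) ordLeq_ordLess_trans by blast
  then show False using cF not_ordLess_ordIso by blast
qed

lemma tournament_on_reoriented:
  assumes T: "tournament_on V R"
  shows "tournament_on V (reoriented R C I)"
proof -
  note D = tournament_onD[OF T]
  have "reoriented R C I \<subseteq> V \<times> V"
    using D(1,2) by (intro subrelI) (simp add: mem_reoriented split: if_splits)
  moreover have "asym (reoriented R C I)"
  proof (rule asymI)
    fix a b assume "(a, b) \<in> reoriented R C I"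
    then show "(b, a) \<notin> reoriented R C I"
      using D(4)[of a b] D(4)[of b a]
      unfolding mem_reoriented touches_commute[of _ b a] by (auto split: if_splits)
  qed
  moreover have "total_on V (reoriented R C I)"
  proof (rule total_onI)
    fix a b assume "a \<in> V" "b \<in> V" "a \<noteq> b"
    then show "(a, b) \<in> reoriented R C I \<or> (b, a) \<in> reoriented R C I"
      using D(5)[of a b] unfolding mem_reoriented touches_commute[of _ b a] by auto
  qed
  ultimately show ?thesis by (simp add: tournament_on_def)
qed

lemma card_UN_ranges_ordLess:
  fixes g :: "'i \<Rightarrow> nat \<Rightarrow> 'a"
  assumes I: "|I| <o |A|" and A: "natLeq <o |A|"
  shows "|\<Union>i\<in>I. range (g i)| <o |A|"
proof -
  let ?K = "I <+> (UNIV :: nat set)"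
  have inf: "infinite A" using A infinite_iff_natLeq_ordLeq ordLess_imp_ordLeq by blast
  have nat: "|UNIV :: nat set| <o |A|" using card_of_nat A by (rule ordIso_ordLess_trans)
  have K: "|?K| <o |A|" by (rule card_of_Plus_ordLess_infinite[OF inf I nat])
  have "|range (g i)| \<le>o |?K|" for i
    by (rule ordLeq_transitive[OF card_of_image card_of_Plus2])
  then have "|\<Union>i\<in>I. range (g i)| \<le>o |?K|"
    by (intro card_of_UNION_ordLeq_infinite) (auto simp: finite_Plus_iff card_of_Plus1)
  then show ?thesis using K by (rule ordLeq_ordLess_trans)
qed

text \<open>The order on first components may vary with the second component. This serves a
  recursion over arcs in which the tails at each head have an order of their own.\<close>

lemma wf_dependent_lex:
  assumes w: "wf w" and s: "\<And>v. wf (s v)"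
  shows "wf {((u', v'), (u, v)). (v', v) \<in> w \<or> v' = v \<and> (u', u) \<in> s v}" (is "wf ?Q")
proof (rule wfUNIVI)
  fix P p
  assume ih: "\<forall>p. (\<forall>q. (q, p) \<in> ?Q \<longrightarrow> P q) \<longrightarrow> P p"
  have "\<forall>u. P (u, v)" for v
  proof (induction v rule: wf_induct_rule[OF w])
    case (1 v)
    have "P (u, v)" for u
    proof (induction u rule: wf_induct_rule[OF s[of v]])
      case inner: (1 u)
      have "P q" if q: "(q, (u, v)) \<in> ?Q" for q
        using q 1 inner by (cases q) auto
      then show ?case using ih by blast
    qed
    then show ?case by blast
  qed
  then show "P p" by (cases p) simp
qed

lemma finite_subsingleton:
  assumes "\<And>x y. x \<in> X \<Longrightarrow> y \<in> X \<Longrightarrow> x = y"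
  shows "finite X"
proof (cases "X = {}")
  case False
  then obtain x where "x \<in> X" by blast
  then have "X \<subseteq> {x}" using assms by blast
  then show ?thesis using finite_subset by blast
qed simp

text \<open>The arc from \<open>u\<close> to \<open>v\<close> is turned around with infinitely many \<open>x\<^sub>n\<close> such that
  \<open>v \<rightarrow> x\<^sub>n \<rightarrow> u\<close>: reversing \<open>u \<rightarrow> v \<rightarrow> x\<^sub>0 \<rightarrow> u\<close> and then all
  \<open>u \<rightarrow> x\<^sub>n \<rightarrow> v \<rightarrow> x\<^sub>n\<^sub>+\<^sub>1 \<rightarrow> u\<close> restores every other arc, as each of them is reversed twice.\<close>

definition detour :: "'a \<times> 'a \<Rightarrow> (nat \<Rightarrow> 'a) \<Rightarrow> nat \<Rightarrow> 'a rel" where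
  "detour e x n = (case e of (u, v) \<Rightarrow> (case n of
      0 \<Rightarrow> {(u, v), (v, x 0), (x 0, u)}
    | Suc m \<Rightarrow> {(u, x m), (x m, v), (v, x (Suc m)), (x (Suc m), u)}))"

lemma short_cycle_detour:
  assumes "u \<noteq> v" "inj x" "u \<notin> range x" "v \<notin> range x"
  shows "short_cycle (detour (u, v) x n)"
proof (cases n)
  case 0
  then have "distinct [u, v, x 0] \<and> detour (u, v) x n = {(u, v), (v, x 0), (x 0, u)}"
    using assms by (auto simp: detour_def)
  then show ?thesis unfolding short_cycle_def by blast
next
  case (Suc m)
  then have "distinct [u, x m, v, x n] \<and>
      detour (u, v) x n = {(u, x m), (x m, v), (v, x n), (x n, u)}"
    using assms by (auto simp: detour_def dest: injD)
  then show ?thesis unfolding short_cycle_def by blast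
qed

lemma touches_detour:
  "touches (detour (u, v) x n) a b \<longleftrightarrow>
     {a, b} = {u, v} \<and> n = 0 \<or>
     (\<exists>k. ({a, b} = {u, x k} \<or> {a, b} = {v, x k}) \<and> (n = k \<or> n = Suc k))"
  by (cases n) (auto simp: touches_def detour_def doubleton_eq_iff)

lemma touches_detour_arc:
  assumes "inj x" "u \<notin> range x" "v \<notin> range x"
  shows "{n. touches (detour (u, v) x n) u v} = {0}" "{n. touches (detour (u, v) x n) v u} = {0}"
  using assms by (auto simp: touches_detour doubleton_eq_iff)

lemma touches_detour_spoke:
  assumes "inj x" "u \<notin> range x" "v \<notin> range x" "w \<in> {u, v}"
  shows "touches (detour (u, v) x n) w (x k) \<longleftrightarrow> n = k \<or> n = Suc k"
    "touches (detour (u, v) x n) (x k) w \<longleftrightarrow> n = k \<or> n = Suc k"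
  using assms by (auto simp: touches_detour doubleton_eq_iff dest: injD)

text \<open>The arc itself lies on the initial triangle only, and each edge between
  \<open>x k\<close> and \<open>u\<close> or \<open>v\<close> lies on the cycles \<open>k\<close>
  and \<open>Suc k\<close>.\<close>

lemma detour_touch_count:
  assumes x: "inj x" "u \<notin> range x" "v \<notin> range x"
  shows "finite {n. touches (detour (u, v) x n) a b}"
    and "even (card {n. touches (detour (u, v) x n) a b}) \<longleftrightarrow> {a, b} \<noteq> {u, v}"
proof -
  consider "{a, b} = {u, v}" | w k where "w \<in> {u, v}" "{a, b} = {w, x k}" "{a, b} \<noteq> {u, v}"
    | "\<forall>n. \<not> touches (detour (u, v) x n) a b" "{a, b} \<noteq> {u, v}"
    unfolding touches_detour by blast
  then have "finite {n. touches (detour (u, v) x n) a b} \<and>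
    (even (card {n. touches (detour (u, v) x n) a b}) \<longleftrightarrow> {a, b} \<noteq> {u, v})"
  proof cases
    case 1
    then have "{n. touches (detour (u, v) x n) a b} = {0}"
      using touches_detour_arc[OF x] by (auto simp: doubleton_eq_iff)
    then show ?thesis using 1 by simp
  next
    case (2 w k)
    then have "{n. touches (detour (u, v) x n) a b} = {k, Suc k}"
      using touches_detour_spoke[OF x 2(1)] by (auto simp: doubleton_eq_iff)
    then show ?thesis using 2 by simp
  next
    case 3
    then show ?thesis by simp
  qed
  then show "finite {n. touches (detour (u, v) x n) a b}"
    and "even (card {n. touches (detour (u, v) x n) a b}) \<longleftrightarrow> {a, b} \<noteq> {u, v}" by blast+
qed



text \<open>Only finitely many blocks touch the edge, each of them evenly. In this way complete
  blocks are seen to leave an edge unchanged.\<close>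

lemma even_card_block_touches:
  assumes fin: "finite {p \<in> J \<times> UNIV. touches (C p) a b}"
    and ev: "\<And>e. e \<in> J \<Longrightarrow> even (card {n::nat. touches (C (e, n)) a b})"
  shows "even (card {p \<in> J \<times> UNIV. touches (C p) a b})"
proof -
  let ?K = "\<lambda>e. {n::nat. touches (C (e, n)) a b}" and ?S = "{p \<in> J \<times> UNIV. touches (C p) a b}"
  have S: "?S = (SIGMA e:fst ` ?S. ?K e)" by force
  have "finite (?K e)" if "e \<in> J" for e
  proof (rule finite_subset)
    show "?K e \<subseteq> snd ` ?S" using that by force
    show "finite (snd ` ?S)" using fin by simp
  qed
  then have "card ?S = (\<Sum>e\<in>fst ` ?S. card (?K e))"
    using fin by (subst S, subst card_SigmaI) auto
  moreover have "even (\<Sum>e\<in>fst ` ?S. card (?K e))"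
    using ev by (intro dvd_sum) auto
  ultimately show ?thesis by simp
qed

text \<open>Each arc of \<open>B\<close> gets its own detour. Detours with a common head or a common
  tail use disjoint vertices, which gives local finiteness. The uncountable out-degree of the head
  ensures that the countable sets chosen for other arcs do not exhaust it.\<close>

lemma reorients_larger_outdegree:
  assumes T: "tournament_on V R"
    and B_def: "B = {(u, v) \<in> R. |R `` {u}| <o |R `` {v}| \<and> natLeq <o |R `` {v}|}"
  shows "reorients V R ((R - B) \<union> B\<inverse>)"
proof -
  let ?N = "\<lambda>u. R `` {u}"
  note D = tournament_onD[OF T]
  have B: "(u, v) \<in> R" "|?N u| <o |?N v|" "natLeq <o |?N v|" if "(u, v) \<in> B" for u v
    using that by (auto simp: B_def)
  have asB: "(v, u) \<notin> R" "(v, u) \<notin> B" if "(u, v) \<in> B" for u v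
    using D(4)[OF B(1)[OF that]] B(1) by blast+
  have inf: "infinite (?N v)" if "natLeq <o |?N v|" for v
    using that infinite_iff_natLeq_ordLeq ordLess_imp_ordLeq by blast
  \<comment> \<open>These tails have out-degree below that of \<open>v\<close>, so
    \<open>card_small_outdegrees\<close> bounds their number by the out-degree of
    \<open>v\<close>.\<close>
  define T where "T v = {u. (u, v) \<in> B}" for v
  have Tle: "|T v| \<le>o |?N v|" if "T v \<noteq> {}" for v
  proof -
    have "infinite (Field |?N v| )" using that inf B(3) by (auto simp: T_def Field_card_of)
    moreover have "T v \<subseteq> V" using B(1) D(1) by (auto simp: T_def)
    moreover have "\<forall>u\<in>T v. |?N u| <o |?N v|" using B(2) by (auto simp: T_def)
    ultimately show ?thesis
      using card_small_outdegrees[OF assms(1) card_of_Card_order] by blast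
  qed
  \<comment> \<open>The candidates for the detour of \<open>u \<rightarrow> v\<close>: outside
    \<open>?N u\<close>, so that \<open>x \<rightarrow> u\<close>, and such that this arc is not
    itself due to be turned around.\<close>
  define S where "S u v = {x \<in> ?N v. x \<notin> ?N u \<and> (x, u) \<notin> B}" for u v
  have S_inf: "infinite (S u v - Y)" if e: "(u, v) \<in> B" and Y: "|Y| <o |?N v|" for u v Y
  proof
    assume "finite (S u v - Y)"
    then have f: "|S u v - Y| <o |?N v|"
      using inf[OF B(3)[OF e]] by (intro finite_card_ordLess)
    have t: "|T u| <o |?N v|"
    proof (cases "T u = {}")
      case True
      then have "finite (T u)" by simp
      then show ?thesis
        using inf[OF B(3)[OF e]] by (intro finite_card_ordLess)
    next
      case False
      show ?thesis by (rule ordLeq_ordLess_trans[OF Tle[OF False] B(2)[OF e]])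
    qed
    note un = card_of_Un_ordLess_infinite[OF inf[OF B(3)[OF e]]]
    have "|(S u v - Y) \<union> (Y \<union> (?N u \<union> T u))| <o |?N v|"
      by (rule un[OF f un[OF Y un[OF B(2)[OF e] t]]])
    moreover have "?N v \<subseteq> (S u v - Y) \<union> (Y \<union> (?N u \<union> T u))" by (auto simp: S_def T_def)
    then have "|?N v| \<le>o |(S u v - Y) \<union> (Y \<union> (?N u \<union> T u))|" by (rule card_of_mono1)
    ultimately show False using not_ordLess_ordLeq by blast
  qed
  obtain w :: "'a rel" where "Well_order w \<and> Field w = UNIV" by (rule exE[OF well_ordering])
  then have w: "Well_order w" "Field w = UNIV" by auto
  have wt: "(a, b) \<in> w - Id \<or> (b, a) \<in> w - Id" if "a \<noteq> b" for a b
    using Well_order_total[OF w(1), of a b] w(2) that by simp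
  let ?t = "\<lambda>v. |T v| - Id"
  have tt: "(a, b) \<in> ?t v \<or> (b, a) \<in> ?t v" if "a \<in> T v" "b \<in> T v" "a \<noteq> b" for a b v
    using Well_order_total[OF card_of_Well_order, of a "T v" b] that by (simp add: Field_card_of)
  \<comment> \<open>Tails at a head \<open>v\<close> follow the cardinal \<open>|T v|\<close>, so
    fewer than \<open>|?N v|\<close> of them precede \<open>u\<close>. For a common tail
    \<open>u\<close> any well-order of the heads will do, as there are at most \<open>|?N u|\<close>
    heads in all.\<close>
  let ?Q = "{((u', v'), (u, v)). (v', v) \<in> w - Id \<or> v' = v \<and> (u', u) \<in> ?t v}"
  define P where "P f e x \<longleftrightarrow> (\<forall>u v. e = (u, v) \<longrightarrow> e \<in> B \<longrightarrow> inj x \<and> range x \<subseteq> S u v \<and>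
      (\<forall>u'. (u', u) \<in> ?t v \<longrightarrow> range x \<inter> range (f (u', v)) = {}) \<and>
      (\<forall>v'. (u, v') \<in> B \<longrightarrow> (v', v) \<in> w - Id \<longrightarrow> range x \<inter> range (f (u, v')) = {}))"
    for f :: "'a \<times> 'a \<Rightarrow> nat \<Rightarrow> 'a" and e and x :: "nat \<Rightarrow> 'a"
  have "\<exists>f. \<forall>e. P f e (f e)"
  proof (rule dependent_wf_choice)
    show "wf ?Q"
      using w(1) card_of_Well_order by (intro wf_dependent_lex) (auto simp: well_order_on_def)
    show "P f e x = P g e x" if fg: "\<And>z. (z, e) \<in> ?Q \<Longrightarrow> f z = g z" for f g e x
    proof -
      obtain u v where e: "e = (u, v)" by (cases e)
      have "f (u', v) = g (u', v)" if "(u', u) \<in> ?t v" for u' using fg[of "(u', v)"] e that by auto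
      moreover have "f (u, v') = g (u, v')" if "(v', v) \<in> w - Id" for v'
        using fg[of "(u, v')"] e that by auto
      ultimately show ?thesis unfolding P_def e by auto
    qed
    show "\<exists>x. P f e x" for e f
    proof -
      obtain u v where e: "e = (u, v)" by (cases e)
      show ?thesis
      proof (cases "e \<in> B")
        case False
        then show ?thesis by (auto simp: P_def)
      next
        case True
        then have eB: "(u, v) \<in> B" using e by simp
        let ?Y1 = "\<Union>u'\<in>underS ( |T v| ) u. range (f (u', v))" and ?Y2 = "\<Union>v'\<in>?N u. range (f (u, v'))"
        have uT: "u \<in> T v" using eB by (simp add: T_def)
        have "|underS ( |T v| ) u| <o |T v|"
          using card_of_underS[OF card_of_Card_order] uT by (simp add: Field_card_of)
        then have "|underS ( |T v| ) u| <o |?N v|"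
          using Tle[of v] uT ordLess_ordLeq_trans by blast
        then have Y1: "|?Y1| <o |?N v|" by (rule card_UN_ranges_ordLess[OF _ B(3)[OF eB]])
        have Y2: "|?Y2| <o |?N v|" by (rule card_UN_ranges_ordLess[OF B(2)[OF eB] B(3)[OF eB]])
        have "|?Y1 \<union> ?Y2| <o |?N v|"
          by (rule card_of_Un_ordLess_infinite[OF inf[OF B(3)[OF eB]] Y1 Y2])
        from infinite_countable_subset[OF S_inf[OF eB this]]
        obtain x :: "nat \<Rightarrow> 'a" where "inj x \<and> range x \<subseteq> S u v - (?Y1 \<union> ?Y2)" by (rule exE)
        then have x: "inj x" "range x \<subseteq> S u v - (?Y1 \<union> ?Y2)" by auto
        have 1: "range x \<inter> range (f (u', v)) = {}" if "(u', u) \<in> ?t v" for u'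
        proof -
          have "u' \<in> underS ( |T v| ) u" using that by (auto simp: underS_def)
          then show ?thesis using x(2) by blast
        qed
        have 2: "range x \<inter> range (f (u, v')) = {}" if "(u, v') \<in> B" for v'
        proof -
          have "v' \<in> ?N u" using B(1)[OF that] by blast
          then show ?thesis using x(2) by blast
        qed
        have "range x \<subseteq> S u v" using x(2) by blast
        then have "P f e x" unfolding P_def e using x(1) 1 2 by simp
        then show ?thesis by blast
      qed
    qed
  qed
  then obtain f where "\<And>e. P f e (f e)" by blast
  then have f: "inj (f (u, v))" "range (f (u, v)) \<subseteq> S u v"
      "\<And>u'. (u', u) \<in> ?t v \<Longrightarrow> range (f (u, v)) \<inter> range (f (u', v)) = {}"
      "\<And>v'. (u, v') \<in> B \<Longrightarrow> (v', v) \<in> w - Id \<Longrightarrow> range (f (u, v)) \<inter> range (f (u, v')) = {}"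
    if "(u, v) \<in> B" for u v
    using that unfolding P_def by simp_all
  have heads: "u = u'" if "(u, v) \<in> B" "(u', v) \<in> B" "y \<in> range (f (u, v))" "y \<in> range (f (u', v))" for u u' v y
    using tt[of u v u'] f(3)[OF that(1), of u'] f(3)[OF that(2), of u] that by (auto simp: T_def)
  have tails: "v = v'" if "(u, v) \<in> B" "(u, v') \<in> B" "y \<in> range (f (u, v))" "y \<in> range (f (u, v'))" for u v v' y
    using wt[of v v'] f(4)[OF that(1,2)] f(4)[OF that(2,1)] that by blast
  have x: "(v, f (u, v) n) \<in> R" "(f (u, v) n, u) \<in> R" "(f (u, v) n, u) \<notin> B" "(u, f (u, v) n) \<notin> R"
    if e: "(u, v) \<in> B" for u v n
  proof -
    have "f (u, v) n \<in> S u v" using f(2)[OF e] by blast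
    then show vx: "(v, f (u, v) n) \<in> R" and "(f (u, v) n, u) \<notin> B" and ux: "(u, f (u, v) n) \<notin> R"
      by (auto simp: S_def)
    have "f (u, v) n \<noteq> u" using vx D(4)[OF B(1)[OF e]] by auto
    then show "(f (u, v) n, u) \<in> R"
      using D(5)[of u "f (u, v) n"] ux D(2)[OF vx] D(1)[OF B(1)[OF e]] by simp
  qed
  have off: "u \<notin> range (f (u, v))" "v \<notin> range (f (u, v))" if e: "(u, v) \<in> B" for u v
    using D(3)[OF x(1)[OF e]] D(3)[OF x(2)[OF e]] by (metis rangeE)+
  define C where "C p = detour (fst p) (f (fst p)) (snd p)" for p :: "('a \<times> 'a) \<times> nat"
  have K: "finite {n. touches (C (e, n)) a b}"
    "even (card {n. touches (C (e, n)) a b}) \<longleftrightarrow> {a, b} \<noteq> {fst e, snd e}" if "e \<in> B" for e a b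
  proof -
    obtain u v where e: "e = (u, v)" by (cases e)
    then have "(u, v) \<in> B" using that by simp
    note detour_touch_count[OF f(1)[OF this] off[OF this], of a b]
    then show "finite {n. touches (C (e, n)) a b}"
      "even (card {n. touches (C (e, n)) a b}) \<longleftrightarrow> {a, b} \<noteq> {fst e, snd e}"
      by (simp_all add: C_def e)
  qed
  have fin: "finite {p \<in> B \<times> UNIV. touches (C p) a b}" for a b
  proof -
    \<comment> \<open>An endpoint of the arc, its role as tail or head, and a vertex of the detour
      determine the arc, by \<open>tails\<close> and \<open>heads\<close>.\<close>
    have one: "finite {e. e \<in> B \<and> fst e = c \<and> d \<in> range (f e)}"
      "finite {e. e \<in> B \<and> snd e = c \<and> d \<in> range (f e)}" for c d
    proof -
      show "finite {e. e \<in> B \<and> fst e = c \<and> d \<in> range (f e)}"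
      proof (rule finite_subsingleton)
        fix e e'
        assume "e \<in> {e. e \<in> B \<and> fst e = c \<and> d \<in> range (f e)}" "e' \<in> {e. e \<in> B \<and> fst e = c \<and> d \<in> range (f e)}"
        then show "e = e'" using tails[of c "snd e" "snd e'" d] by (cases e; cases e') auto
      qed
      show "finite {e. e \<in> B \<and> snd e = c \<and> d \<in> range (f e)}"
      proof (rule finite_subsingleton)
        fix e e'
        assume "e \<in> {e. e \<in> B \<and> snd e = c \<and> d \<in> range (f e)}" "e' \<in> {e. e \<in> B \<and> snd e = c \<and> d \<in> range (f e)}"
        then show "e = e'" using heads[of "fst e" c "fst e'" d] by (cases e; cases e') auto
      qed
    qed
    let ?E = "{(a, b), (b, a)} \<union>
      {e. e \<in> B \<and> fst e = a \<and> b \<in> range (f e)} \<union> {e. e \<in> B \<and> snd e = a \<and> b \<in> range (f e)} \<union>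
      {e. e \<in> B \<and> fst e = b \<and> a \<in> range (f e)} \<union> {e. e \<in> B \<and> snd e = b \<and> a \<in> range (f e)}"
    have "e \<in> ?E" if "e \<in> B" "touches (C (e, n)) a b" for e n
      using that by (cases e) (auto simp: C_def touches_detour doubleton_eq_iff)
    then have "{p \<in> B \<times> UNIV. touches (C p) a b} \<subseteq> (SIGMA e:?E \<inter> B. {n. touches (C (e, n)) a b})" by auto
    moreover have "finite (SIGMA e:?E \<inter> B. {n. touches (C (e, n)) a b})"
      using one K(1) by (intro finite_SigmaI) auto
    ultimately show ?thesis by (rule finite_subset)
  qed
  have fin': "finite {p \<in> J. touches (C p) a b}" if "J \<subseteq> B \<times> UNIV" for J a b
    using that by (intro finite_subset[OF _ fin[of a b]]) blast

  txt \<open>The blocks are ordered by the out-degree of the tail. An arc \<open>v \<rightarrow> x\<close> that is used by the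
    block of \<open>u \<rightarrow> v\<close> may belong to \<open>B\<close>, but then it is turned around later.\<close>
  define c where "c u = (SOME q :: 'a rel. q =o |?N u| )" for u
  have cN: "c u =o |?N u|" for u
    unfolding c_def using ordIso_reflexive[OF card_of_Well_order] by (rule someI)
  have c_less: "(c u, c v) \<in> ordLess \<longleftrightarrow> |?N u| <o |?N v|" for u v
    using cN ordIso_symmetric ordIso_ordLess_trans ordLess_ordIso_trans by metis
  \<comment> \<open>\<open><*lex*>\<close> passes to its second component only on equality, so
    isomorphic cardinals need the same representative.\<close>
  have c_eq: "c u = c v" if "|?N u| =o |?N v|" for u v
  proof -
    have "(\<lambda>q :: 'a rel. q =o |?N u| ) = (\<lambda>q. q =o |?N v| )"
      using that ordIso_symmetric ordIso_transitive by metis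
    then show ?thesis unfolding c_def by simp
  qed
  obtain z :: "('a \<times> 'a) rel" where "Well_order z \<and> Field z = UNIV" by (rule exE[OF well_ordering])
  then have z: "Well_order z" "Field z = UNIV" by auto
  define s where "s = inv_image (ordLess <*lex*> (z - Id)) (\<lambda>e :: 'a \<times> 'a. (c (fst e), e))"
  have "wf s"
    unfolding s_def using z(1) by (intro wf_inv_image wf_lex_prod wf_ordLess) (simp add: well_order_on_def)
  moreover have "trans s"
  proof -
    have "trans (z - Id)"
      using z(1) by (auto simp: order_on_defs intro: trans_diff_Id)
    moreover have "trans (ordLess :: 'a rel rel)"
      by (rule transI) (rule ordLess_transitive)
    ultimately show ?thesis unfolding s_def by (intro trans_inv_image trans_lex_prod)
  qed
  moreover have "total_on B s"
  proof (rule total_onI)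
    fix e e' :: "'a \<times> 'a" assume ne: "e \<noteq> e'"
    consider "|?N (fst e)| <o |?N (fst e')|" | "|?N (fst e')| <o |?N (fst e)|" | "|?N (fst e)| =o |?N (fst e')|"
      using ordLeq_total[OF card_of_Well_order card_of_Well_order] ordLeq_iff_ordLess_or_ordIso ordIso_symmetric
      by metis
    then show "(e, e') \<in> s \<or> (e', e) \<in> s"
    proof cases
      case 3
      have "(e, e') \<in> z - Id \<or> (e', e) \<in> z - Id"
        using Well_order_total[OF z(1), of e e'] z(2) ne by simp
      then show ?thesis using c_eq[OF 3] by (auto simp: s_def)
    qed (auto simp: s_def c_less)
  qed
  moreover have "short_cycle (C (e, n))" if "e \<in> B" for e n
    using that short_cycle_detour[OF D(3)[OF B(1)] f(1) off, of "fst e" "snd e"]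
    by (cases e) (auto simp: C_def)
  moreover have "C (e, n) \<subseteq> reoriented R C ({e'\<in>B. (e', e) \<in> s} \<times> UNIV \<union> {e} \<times> {..<n})"
    if e: "e \<in> B" for e n
  proof -
    obtain u v where uv: "e = (u, v)" by (cases e)
    let ?J = "{e'\<in>B. (e', e) \<in> s}" and ?x = "f (u, v)"
    have eB: "(u, v) \<in> B" using e uv by simp
    note spoke = touches_detour_spoke[OF f(1)[OF eB] off[OF eB]]
    have irr: "(e, e) \<notin> s" using \<open>wf s\<close> by simp
    \<comment> \<open>Earlier blocks are complete and could change an edge of this detour only by
      being its own block. That is ruled out: \<open>?x k \<rightarrow> u\<close> is not in
      \<open>B\<close>, and a block of \<open>v \<rightarrow> ?x k\<close> comes later, as
      \<open>v\<close> has larger out-degree than \<open>u\<close>.\<close>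
    have parity: "even (card {p \<in> ?J \<times> UNIV \<union> {e} \<times> {..<n}. touches (C p) a b}) \<longleftrightarrow>
        even (card {m. m < n \<and> touches (C (e, m)) a b})"
      if ab: "(a, b) \<in> {(u, v), (v, ?x k), (?x k, u), (u, ?x k), (?x k, v)}" for a b k
    proof -
      have "{a, b} \<noteq> {fst e', snd e'}" if e': "e' \<in> ?J" for e'
      proof
        assume eq: "{a, b} = {fst e', snd e'}"
        obtain u' v' where uv': "e' = (u', v')" by (cases e')
        have "(v, ?x k) \<notin> ?J"
        proof
          assume "(v, ?x k) \<in> ?J"
          then have "(c v, c u) \<in> ordLess \<or> c v = c u" by (auto simp: s_def uv)
          moreover have "(c u, c v) \<in> ordLess" using c_less B(2)[OF eB] by blast
          ultimately show False
            using wf_asym[OF wf_ordLess] by metis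
        qed
        moreover have "(u', v') \<in> R" using e' uv' B(1) by blast
        moreover have "(u', v') \<noteq> (u, v)" using e' uv uv' irr by auto
        ultimately show False
          using eq ab x[OF eB, of k] B(1)[OF eB] D(4) e' uv' by (auto simp: doubleton_eq_iff)
      qed
      then have "even (card {p \<in> ?J \<times> UNIV. touches (C p) a b})"
        using K(2) by (intro even_card_block_touches fin') auto
      moreover have "{p \<in> ?J \<times> UNIV \<union> {e} \<times> {..<n}. touches (C p) a b} =
          {p \<in> ?J \<times> UNIV. touches (C p) a b} \<union> {p \<in> {e} \<times> {..<n}. touches (C p) a b}" by blast
      moreover have "card ({p \<in> ?J \<times> UNIV. touches (C p) a b} \<union> {p \<in> {e} \<times> {..<n}. touches (C p) a b}) =
          card {p \<in> ?J \<times> UNIV. touches (C p) a b} + card {p \<in> {e} \<times> {..<n}. touches (C p) a b}"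
        using irr e by (intro card_Un_disjoint fin') auto
      moreover have "card {p \<in> {e} \<times> {..<n}. touches (C p) a b} = card {m. m < n \<and> touches (C (e, m)) a b}"
        by (rule bij_betw_same_card[of snd]) (force simp: bij_betw_def inj_on_def)
      ultimately show ?thesis by simp
    qed
    show ?thesis
    proof (rule subrelI)
      fix a b assume ab: "(a, b) \<in> C (e, n)"
      show "(a, b) \<in> reoriented R C (?J \<times> UNIV \<union> {e} \<times> {..<n})"
      proof (cases n)
        case 0
        then have ab0: "(a, b) \<in> {(u, v), (v, ?x 0), (?x 0, u)}" using ab by (simp add: C_def detour_def uv)
        then have "(a, b) \<in> R" using x[OF eB] B(1)[OF eB] by auto
        moreover have "even (card {p \<in> ?J \<times> UNIV \<union> {e} \<times> {..<n}. touches (C p) a b})"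
          using parity[of a b 0] ab0 0 by auto
        ultimately show ?thesis unfolding mem_reoriented by simp
      next
        case (Suc m)
        then have "(a, b) \<in> {(u, ?x m), (?x m, v)} \<or> (a, b) \<in> {(v, ?x n), (?x n, u)}"
          using ab by (auto simp: C_def detour_def uv)
        then show ?thesis
        proof
          assume abm: "(a, b) \<in> {(u, ?x m), (?x m, v)}"
          \<comment> \<open>The edges at \<open>?x m\<close> lie on the cycles \<open>m\<close> and
            \<open>Suc m = n\<close>; only the former is earlier.\<close>
          then have "{i. i < n \<and> touches (C (e, i)) a b} = {m}"
            using spoke Suc by (auto simp: C_def uv)
          then have "odd (card {p \<in> ?J \<times> UNIV \<union> {e} \<times> {..<n}. touches (C p) a b})"
            using parity[of a b m] abm by auto
          moreover have "(b, a) \<in> R" using abm x[OF eB] by auto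
          ultimately show ?thesis unfolding mem_reoriented by simp
        next
          assume abn: "(a, b) \<in> {(v, ?x n), (?x n, u)}"
          then have "{i. i < n \<and> touches (C (e, i)) a b} = {}"
            using spoke by (auto simp: C_def uv)
          then have "even (card {i. i < n \<and> touches (C (e, i)) a b})" by (simp only: card.empty even_zero)
          then have "even (card {p \<in> ?J \<times> UNIV \<union> {e} \<times> {..<n}. touches (C p) a b})"
            using parity[of a b n] abn by blast
          moreover have "(a, b) \<in> R" using abn x[OF eB] by auto
          ultimately show ?thesis unfolding mem_reoriented by simp
        qed
      qed
    qed
  qed
  ultimately have run: "reversal_run R (block_order B s) C"
    using fin by (intro block_run) auto
  \<comment> \<open>An edge is touched oddly by the block of its own arc, if that arc is in
    \<open>B\<close>, and evenly by all others.\<close>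
  have "reoriented R C (B \<times> UNIV) = (R - B) \<union> B\<inverse>"
  proof -
    have "(a, b) \<in> reoriented R C (B \<times> UNIV) \<longleftrightarrow> (a, b) \<in> (R - B) \<union> B\<inverse>" for a b
    proof (cases "(a, b) \<in> B \<or> (b, a) \<in> B")
      case False
      then have "even (card {p \<in> B \<times> UNIV. touches (C p) a b})"
        using K(2) fin by (intro even_card_block_touches) (auto simp: doubleton_eq_iff)
      then show ?thesis unfolding mem_reoriented using False by auto
    next
      case True
      then obtain e where e: "e \<in> B" "{a, b} = {fst e, snd e}" by fastforce
      have "{a, b} \<noteq> {fst e', snd e'}" if "e' \<in> B - {e}" for e'
        using that e asB[of a b] asB[of b a] by (cases e; cases e') (auto simp: doubleton_eq_iff)
      then have "even (card {p \<in> (B - {e}) \<times> UNIV. touches (C p) a b})"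
        using K(2) by (intro even_card_block_touches fin') auto
      moreover have "{p \<in> B \<times> UNIV. touches (C p) a b} =
          {p \<in> (B - {e}) \<times> UNIV. touches (C p) a b} \<union> {p \<in> {e} \<times> UNIV. touches (C p) a b}" using e by blast
      moreover have "card ({p \<in> (B - {e}) \<times> UNIV. touches (C p) a b} \<union> {p \<in> {e} \<times> UNIV. touches (C p) a b}) =
          card {p \<in> (B - {e}) \<times> UNIV. touches (C p) a b} + card {p \<in> {e} \<times> UNIV. touches (C p) a b}"
        using e by (intro card_Un_disjoint fin') auto
      moreover have "card {p \<in> {e} \<times> UNIV. touches (C p) a b} = card {m. touches (C (e, m)) a b}"
        by (rule bij_betw_same_card[of snd]) (force simp: bij_betw_def inj_on_def)
      moreover have "odd (card {m. touches (C (e, m)) a b})" using K(2)[OF e(1)] e(2) by blast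
      ultimately have "odd (card {p \<in> B \<times> UNIV. touches (C p) a b})" by simp
      then show ?thesis
        unfolding mem_reoriented using True asB[of a b] asB[of b a] B(1)[of a b] B(1)[of b a] by auto
    qed
    then show ?thesis by auto
  qed
  moreover have "B \<subseteq> V \<times> V"
    using D(1)[OF B(1)] D(2)[OF B(1)] by (intro subrelI SigmaI)
  ultimately show ?thesis
    unfolding reorients_def using run by (intro disjI2 exI[of _ "block_order B s"] exI[of _ C]) (auto simp: Field_block_order)
qed

section \<open>Finite out-degrees\<close>

text \<open>Every vertex other than \<open>w\<close> reached outside \<open>P\<close> is also
  reached, without returning to \<open>w\<close>, from one of the finitely many successors of
  \<open>w\<close>; so one of these reaches infinitely many.\<close>

lemma infinite_reach_step:
  assumes fin: "finite (G `` {w})"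
    and inf: "infinite ((G \<inter> (- P) \<times> (- P))\<^sup>* `` {w})" and w: "w \<notin> P"
  shows "\<exists>w'. (w, w') \<in> G \<and> w' \<notin> insert w P \<and>
    infinite ((G \<inter> (- insert w P) \<times> (- insert w P))\<^sup>* `` {w'})"
proof (rule ccontr)
  let ?G = "G \<inter> (- insert w P) \<times> (- insert w P)"
  let ?M = "G `` {w} - insert w P"
  assume no: "\<not> ?thesis"
  have "y \<in> insert w (\<Union>w'\<in>?M. ?G\<^sup>* `` {w'})" if "(w, y) \<in> (G \<inter> (- P) \<times> (- P))\<^sup>*" for y
    using that
  proof (induction rule: rtrancl_induct)
    case base
    then show ?case by simp
  next
    case (step y z)
    show ?case
    proof (cases "z = w \<or> y = w")
      case True
      then show ?thesis using step.hyps(2) by auto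
    next
      case False
      then obtain w' where "w' \<in> ?M" "(w', y) \<in> ?G\<^sup>*" using step.IH by blast
      moreover have "(y, z) \<in> ?G" using step.hyps(2) False by blast
      ultimately have "w' \<in> ?M" "(w', z) \<in> ?G\<^sup>*" by (auto intro: rtrancl_into_rtrancl)
      then show ?thesis by blast
    qed
  qed
  then have "(G \<inter> (- P) \<times> (- P))\<^sup>* `` {w} \<subseteq> insert w (\<Union>w'\<in>?M. ?G\<^sup>* `` {w'})" by blast
  moreover have "finite (insert w (\<Union>w'\<in>?M. ?G\<^sup>* `` {w'}))" using no fin by blast
  ultimately show False using inf finite_subset by blast
qed

text \<open>Koenig's lemma for reachability.\<close>

lemma infinite_reach_ray:
  assumes fin: "\<And>a. finite (G `` {a})" and inf: "infinite (G\<^sup>* `` {v})"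
  shows "\<exists>x :: nat \<Rightarrow> 'a. x 0 = v \<and> inj x \<and> (\<forall>n. (x n, x (Suc n)) \<in> G)"
proof -
  \<comment> \<open>A state holds the vertices already passed and the current vertex, from which
    infinitely many vertices are reachable off the passed ones.\<close>
  define ok where "ok n s \<longleftrightarrow> (n = 0 \<longrightarrow> s = ({}, v)) \<and> snd s \<notin> fst s \<and>
      infinite ((G \<inter> (- fst s) \<times> (- fst s))\<^sup>* `` {snd s})" for n :: nat and s :: "'a set \<times> 'a"
  have "\<exists>f. \<forall>n. ok n (f n) \<and>
      (fst (f (Suc n)) = insert (snd (f n)) (fst (f n)) \<and> (snd (f n), snd (f (Suc n))) \<in> G)"
  proof (rule dependent_nat_choice)
    show "\<exists>s. ok 0 s" using inf by (intro exI[of _ "({}, v)"]) (simp add: ok_def)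
    fix s n assume s: "ok n s"
    then obtain w' where w': "(snd s, w') \<in> G" "w' \<notin> insert (snd s) (fst s)"
        "infinite ((G \<inter> (- insert (snd s) (fst s)) \<times> (- insert (snd s) (fst s)))\<^sup>* `` {w'})"
      using infinite_reach_step[of G "snd s" "fst s"] fin by (auto simp: ok_def)
    show "\<exists>t. ok (Suc n) t \<and> fst t = insert (snd s) (fst s) \<and> (snd s, snd t) \<in> G"
      using w' by (intro exI[of _ "(insert (snd s) (fst s), w')"]) (simp add: ok_def)
  qed
  then obtain f where f: "\<And>n. ok n (f n)" "\<And>n. fst (f (Suc n)) = insert (snd (f n)) (fst (f n))"
      "\<And>n. (snd (f n), snd (f (Suc n))) \<in> G" by blast
  have mem: "snd (f m) \<in> fst (f n)" if "m < n" for m n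
    using that
  proof (induction n)
    case (Suc n)
    then show ?case using f(2)[of n] by (cases "m = n") auto
  qed simp
  have "snd (f m) \<noteq> snd (f n)" if "m < n" for m n
    using mem[OF that] f(1)[of n] by (auto simp: ok_def)
  then have "inj (\<lambda>n. snd (f n))" by (metis injI linorder_neqE_nat)
  moreover have "snd (f 0) = v" using f(1)[of 0] by (simp add: ok_def)
  ultimately show ?thesis using f(3) by (intro exI[of _ "\<lambda>n. snd (f n)"]) simp
qed

section \<open>Fans: pushing an arc to infinity along a ray\<close>

definition fan :: "'a \<Rightarrow> (nat \<Rightarrow> 'a) \<Rightarrow> nat \<Rightarrow> 'a rel" where
  "fan u x n = {(u, x n), (x n, x (Suc n)), (x (Suc n), u)}"

text \<open>Past \<open>x 0\<close> the ray points back to \<open>u\<close>. Reversing triangle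
  \<open>n\<close> of the fan turns \<open>x (Suc n) \<rightarrow> u\<close> into the arc with which
  triangle \<open>Suc n\<close> starts.\<close>

definition ray_at :: "'a rel \<Rightarrow> 'a \<Rightarrow> (nat \<Rightarrow> 'a) \<Rightarrow> bool" where
  "ray_at R u x \<longleftrightarrow> inj x \<and> u \<notin> range x \<and> (u, x 0) \<in> R \<and>
     (\<forall>n. (x n, x (Suc n)) \<in> R \<and> (x (Suc n), u) \<in> R)"

lemma touches_fan:
  "touches (fan u x n) a b \<longleftrightarrow>
     {a, b} = {u, x n} \<or> {a, b} = {x n, x (Suc n)} \<or> {a, b} = {u, x (Suc n)}"
  by (auto simp: touches_def fan_def doubleton_eq_iff)

lemma short_cycle_fan:
  assumes "ray_at R u x"
  shows "short_cycle (fan u x n)"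
proof -
  have "distinct [u, x n, x (Suc n)]"
    using assms by (auto simp: ray_at_def inj_eq)
  then show ?thesis unfolding short_cycle_def fan_def by blast
qed

lemma fan_touch_sets:
  assumes "inj x" "u \<notin> range x"
  shows "{n. touches (fan u x n) u (x 0)} = {0}"
    and "{n. touches (fan u x n) u (x (Suc k))} = {k, Suc k}"
    and "{n. touches (fan u x n) (x k) (x (Suc k))} = {k}"
  using assms by (auto simp: touches_fan doubleton_eq_iff inj_eq)

lemma finite_fan_touches:
  assumes x: "inj x" "u \<notin> range x"
  shows "finite {n. touches (fan u x n) a b}"
proof (cases "\<exists>n. touches (fan u x n) a b")
  case True
  then obtain k where "{a, b} = {u, x 0} \<or> {a, b} = {u, x (Suc k)} \<or> {a, b} = {x k, x (Suc k)}"
    unfolding touches_fan by (metis not0_implies_Suc)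
  moreover have "{n. touches (fan u x n) a b} = {n. touches (fan u x n) c d}" if "{a, b} = {c, d}" for c d
    using that by (auto simp: touches_fan)
  ultimately show ?thesis using fan_touch_sets[OF x] by (metis finite.emptyI finite.insertI)
qed simp

text \<open>The edges from \<open>u\<close> to \<open>x (Suc k)\<close> are used twice and thus
  restored; only the first edge at \<open>u\<close> and the edges of the ray can end up turned
  around.\<close>

lemma odd_fan_touches:
  assumes x: "inj x" "u \<notin> range x" and odd: "odd (card {n. touches (fan u x n) a b})"
  shows "{a, b} = {u, x 0} \<or> (\<exists>k. {a, b} = {x k, x (Suc k)})"
proof (rule ccontr)
  assume no: "\<not> ?thesis"
  have eq: "{n. touches (fan u x n) a b} = {n. touches (fan u x n) c d}" if "{a, b} = {c, d}" for c d
    using that by (auto simp: touches_fan)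
  have "{n. touches (fan u x n) a b} \<noteq> {}" using odd by (metis card.empty even_zero)
  then obtain k where "{a, b} = {u, x (Suc k)}"
    using no unfolding touches_fan by (auto; metis not0_implies_Suc)
  then have "{n. touches (fan u x n) a b} = {k, Suc k}" using eq fan_touch_sets(2)[OF x] by metis
  then show False using odd by simp
qed

lemma fan_subset_reoriented:
  assumes "ray_at R u x"
  shows "fan u x n \<subseteq> reoriented R (fan u x) {..<n}"
proof -
  have x: "inj x" "u \<notin> range x" and R: "(u, x 0) \<in> R" "\<And>n. (x n, x (Suc n)) \<in> R" "\<And>n. (x (Suc n), u) \<in> R"
    using assms by (auto simp: ray_at_def)
  have "{i\<in>{..<n}. touches (fan u x i) (x n) (x (Suc n))} = {}"
    using x by (auto simp: touches_fan doubleton_eq_iff inj_eq)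
  then have 1: "(x n, x (Suc n)) \<in> reoriented R (fan u x) {..<n}" using R mem_reoriented_untouched by metis
  have "{i\<in>{..<n}. touches (fan u x i) (x (Suc n)) u} = {}"
    using x by (auto simp: touches_fan doubleton_eq_iff inj_eq)
  then have 2: "(x (Suc n), u) \<in> reoriented R (fan u x) {..<n}" using R mem_reoriented_untouched by metis
  have "(u, x n) \<in> reoriented R (fan u x) {..<n}"
  proof (cases n)
    case 0
    then show ?thesis using R by simp
  next
    case (Suc m)
    have "{i\<in>{..<n}. touches (fan u x i) u (x n)} = {m}"
      using x Suc by (auto simp: touches_fan doubleton_eq_iff inj_eq)
    then show ?thesis unfolding mem_reoriented using R(3)[of m] Suc by simp
  qed
  then show ?thesis using 1 2 by (auto simp: fan_def)
qed

lemma finite_outdegree_ray: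
  assumes ray: "ray_at R u x" and fin: "\<And>v. finite (R `` {v})"
  shows "finite (reoriented R (fan u x) UNIV `` {v})"
proof -
  have x: "inj x" "u \<notin> range x" using ray by (auto simp: ray_at_def)
  have "b \<in> R `` {v} \<union> {u, x 0} \<union> {b. \<exists>k. {v, b} = {x k, x (Suc k)}}"
    if "(v, b) \<in> reoriented R (fan u x) UNIV" for b
    using that odd_fan_touches[OF x, of v b] unfolding mem_reoriented
    by (auto simp: doubleton_eq_iff split: if_splits)
  then have "reoriented R (fan u x) UNIV `` {v} \<subseteq>
      R `` {v} \<union> {u, x 0} \<union> {b. \<exists>k. {v, b} = {x k, x (Suc k)}}" by blast
  moreover have "finite {b. \<exists>k. {v, b} = {x k, x (Suc k)}}"
  proof (cases "v \<in> range x")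
    case True
    then obtain j where "v = x j" by blast
    \<comment> \<open>For \<open>j = 0\<close> the truncated \<open>j - 1\<close> contributes
      \<open>x 0\<close> itself, which is harmless in an upper bound.\<close>
    then have "{b. \<exists>k. {v, b} = {x k, x (Suc k)}} \<subseteq> {x (Suc j), x (j - 1)}"
      using x(1) by (auto simp: doubleton_eq_iff inj_eq)
    then show ?thesis by (rule finite_subset) simp
  next
    case False
    then have "{b. \<exists>k. {v, b} = {x k, x (Suc k)}} = {}" by (auto simp: doubleton_eq_iff)
    then show ?thesis by (simp only: finite.emptyI)
  qed
  ultimately show ?thesis using fin by (auto intro: finite_subset)
qed

text \<open>A ray that entered \<open>W\<close> would stay in it, and \<open>W\<close> is finite;
  \<open>u\<close> lies outside because of its arc to \<open>x 0\<close>. Hence fans never disturb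
  closed sets found earlier.\<close>

lemma fan_avoids_closed:
  assumes ray: "ray_at R u x" and W: "finite W" "R `` W \<subseteq> W" and t: "touches (fan u x n) a b"
  shows "a \<notin> W" "b \<notin> W"
proof -
  have inj: "inj x" and R: "(u, x 0) \<in> R" "\<And>n. (x n, x (Suc n)) \<in> R"
    using ray by (auto simp: ray_at_def)
  have xW: "x n \<notin> W" for n
  proof
    assume n: "x n \<in> W"
    have "x (n + k) \<in> W" for k by (induction k) (use n R(2) W(2) in auto)
    then have "range (\<lambda>k. x (n + k)) \<subseteq> W" by blast
    moreover have "infinite (range (\<lambda>k. x (n + k)))"
      using inj by (intro range_inj_infinite injI) (simp add: inj_eq)
    ultimately show False using W(1) finite_subset by blast
  qed
  moreover have "u \<notin> W" using xW[of 0] R(1) W(2) by blast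
  ultimately show "a \<notin> W" "b \<notin> W" using t by (auto simp: touches_fan doubleton_eq_iff)
qed

section \<open>Minimum cuts around a finite set\<close>

definition out_cut :: "'a rel \<Rightarrow> 'a set \<Rightarrow> 'a rel" where
  "out_cut R W = {(a, b) \<in> R. a \<in> W \<and> b \<notin> W}"

definition min_cut :: "'a set \<Rightarrow> 'a rel \<Rightarrow> 'a set \<Rightarrow> nat" where
  "min_cut V R F = (LEAST n. \<exists>W. finite W \<and> F \<subseteq> W \<and> W \<subseteq> V \<and> card (out_cut R W) = n)"

lemma min_cut_le: "finite W \<Longrightarrow> F \<subseteq> W \<Longrightarrow> W \<subseteq> V \<Longrightarrow> min_cut V R F \<le> card (out_cut R W)"
  unfolding min_cut_def by (rule Least_le) blast

lemma min_cut_attained: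
  assumes "finite F" "F \<subseteq> V"
  shows "\<exists>W. finite W \<and> F \<subseteq> W \<and> W \<subseteq> V \<and> card (out_cut R W) = min_cut V R F"
proof -
  have "\<exists>n W. finite W \<and> F \<subseteq> W \<and> W \<subseteq> V \<and> card (out_cut R W) = n" using assms by blast
  then show ?thesis unfolding min_cut_def by (rule LeastI_ex)
qed

lemma finite_out_cut:
  assumes "\<And>v. finite (R `` {v})" "finite W"
  shows "finite (out_cut R W)"
proof (rule finite_subset)
  show "out_cut R W \<subseteq> (SIGMA a:W. R `` {a})" by (auto simp: out_cut_def)
  show "finite (SIGMA a:W. R `` {a})" using assms by blast
qed

text \<open>If \<open>W\<close> minimises the cut, then the head of an arc leaving \<open>W\<close> reaches infinitely many
  vertices outside \<open>W\<close>: otherwise adding them to \<open>W\<close> makes the cut smaller.\<close>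

lemma exists_cut_decreasing_ray:
  assumes T: "tournament_on V R" and fin: "\<And>v. finite (R `` {v})"
    and F: "finite F" "F \<subseteq> V"
    and no: "\<not> (\<exists>W. finite W \<and> F \<subseteq> W \<and> W \<subseteq> V \<and> R `` W \<subseteq> W)"
  shows "\<exists>u x. ray_at R u x \<and> min_cut V (reoriented R (fan u x) UNIV) F < min_cut V R F"
proof -
  note D = tournament_onD[OF T]
  obtain W where W: "finite W" "F \<subseteq> W" "W \<subseteq> V" "card (out_cut R W) = min_cut V R F"
    using min_cut_attained[OF F] by blast
  have "\<not> R `` W \<subseteq> W" using no W by blast
  then obtain u v where uv: "u \<in> W" "(u, v) \<in> R" "v \<notin> W" by blast
  let ?G = "R \<inter> (- W) \<times> (- W)"
  have finG: "finite (?G `` {a})" for a by (rule finite_subset[OF _ fin[of a]]) blast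
  have "infinite (?G\<^sup>* `` {v})"
  proof
    let ?Q = "?G\<^sup>* `` {v}"
    assume Q: "finite ?Q"
    have QV: "?Q \<subseteq> V"
    proof
      fix y assume "y \<in> ?Q"
      then have "(v, y) \<in> ?G\<^sup>*" by blast
      then show "y \<in> V" by (cases rule: rtranclE) (use uv(2) D(2) in blast)+
    qed
    \<comment> \<open>Arcs from \<open>?Q\<close> lead into \<open>W\<close> or stay in
      \<open>?Q\<close>, so only arcs from \<open>W\<close> can leave the union, and
      \<open>u \<rightarrow> v\<close> no longer does.\<close>
    have "out_cut R (W \<union> ?Q) \<subseteq> out_cut R W - {(u, v)}"
    proof (rule subrelI)
      fix a b assume "(a, b) \<in> out_cut R (W \<union> ?Q)"
      then have ab: "(a, b) \<in> R" "a \<in> W \<union> ?Q" "b \<notin> W" "b \<notin> ?Q" by (auto simp: out_cut_def)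
      have "a \<in> W"
      proof (rule ccontr)
        assume "a \<notin> W"
        then have "(v, a) \<in> ?G\<^sup>*" "(a, b) \<in> ?G" using ab by auto
        then have "(v, b) \<in> ?G\<^sup>*" by (rule rtrancl_into_rtrancl)
        then show False using ab(4) by blast
      qed
      moreover have "b \<noteq> v" using ab(4) by auto
      ultimately show "(a, b) \<in> out_cut R W - {(u, v)}" using ab by (auto simp: out_cut_def)
    qed
    moreover have "(u, v) \<in> out_cut R W" using uv by (simp add: out_cut_def)
    ultimately have "card (out_cut R (W \<union> ?Q)) < card (out_cut R W)"
      using finite_out_cut[OF fin W(1)] by (intro psubset_card_mono) auto
    moreover have "min_cut V R F \<le> card (out_cut R (W \<union> ?Q))"
      using W Q QV by (intro min_cut_le) auto
    ultimately show False using W(4) by simp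
  qed
  then obtain y :: "nat \<Rightarrow> 'a" where y: "y 0 = v" "inj y" "\<And>n. (y n, y (Suc n)) \<in> ?G"
    using infinite_reach_ray[OF finG] by blast
  have "finite {m. (u, y m) \<in> R}"
  proof (rule finite_imageD)
    show "finite (y ` {m. (u, y m) \<in> R})" by (rule finite_subset[OF _ fin[of u]]) blast
    show "inj_on y {m. (u, y m) \<in> R}" using y(2) by (rule inj_on_subset) simp
  qed
  moreover have "0 \<in> {m. (u, y m) \<in> R}" using uv y by simp
  ultimately obtain m where m: "(u, y m) \<in> R" "\<And>k. (u, y k) \<in> R \<Longrightarrow> k \<le> m"
    using Max_in Max_ge by (metis empty_iff mem_Collect_eq)
  \<comment> \<open>The ray is cut off before the last out-neighbour of \<open>u\<close> on it,
    which exists as \<open>u\<close> has finite out-degree; all later vertices then point to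
    \<open>u\<close>.\<close>
  define x where "x n = y (m + n)" for n
  have yW: "y n \<notin> W" for n using y(3)[of n] by blast
  have xW: "x n \<notin> W" for n by (simp add: x_def yW)
  have ux: "u \<notin> range x" using xW uv(1) by blast
  have xR: "(x n, x (Suc n)) \<in> R" for n using y(3)[of "m + n"] by (simp add: x_def)
  have xu: "(x (Suc n), u) \<in> R" for n
  proof -
    have "(u, x (Suc n)) \<notin> R" using m(2)[of "m + Suc n"] by (auto simp: x_def)
    moreover have "x (Suc n) \<noteq> u" using ux by blast
    ultimately show ?thesis using D(5)[of u "x (Suc n)"] D(1)[OF uv(2)] D(2)[OF xR[of n]] by auto
  qed
  have injx: "inj x" using y(2) by (intro injI) (simp add: x_def inj_eq)
  have x0: "(u, x 0) \<in> R" using m(1) by (simp add: x_def)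
  have ray: "ray_at R u x" unfolding ray_at_def using injx ux xR xu x0 by blast
  let ?R = "reoriented R (fan u x) UNIV"
  \<comment> \<open>The other edges that the fan turns around belong to the ray, which runs outside
    \<open>W\<close>.\<close>
  have "out_cut ?R W \<subseteq> out_cut R W - {(u, x 0)}"
  proof (rule subrelI)
    fix a b assume "(a, b) \<in> out_cut ?R W"
    then have ab: "(a, b) \<in> ?R" "a \<in> W" "b \<notin> W" by (auto simp: out_cut_def)
    have "(u, x 0) \<notin> ?R"
    proof -
      have "{n \<in> UNIV. touches (fan u x n) u (x 0)} = {0}" using fan_touch_sets(1)[OF injx ux] by simp
      then show ?thesis unfolding mem_reoriented using D(4)[OF x0] by simp
    qed
    then have ne: "(a, b) \<noteq> (u, x 0)" using ab(1) by metis
    have "even (card {n. touches (fan u x n) a b})"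
    proof (rule ccontr)
      assume "odd (card {n. touches (fan u x n) a b})"
      then have "{a, b} = {u, x 0} \<or> (\<exists>k. {a, b} = {x k, x (Suc k)})"
        by (rule odd_fan_touches[OF injx ux])
      then show False using ne ab(2,3) uv(1) xW by (auto simp: doubleton_eq_iff)
    qed
    then have "(a, b) \<in> R" using ab(1) unfolding mem_reoriented by simp
    then show "(a, b) \<in> out_cut R W - {(u, x 0)}" using ab ne by (auto simp: out_cut_def)
  qed
  moreover have "(u, x 0) \<in> out_cut R W" using x0 uv(1) xW by (simp add: out_cut_def)
  ultimately have "card (out_cut ?R W) < card (out_cut R W)"
    using finite_out_cut[OF fin W(1)] by (intro psubset_card_mono) auto
  moreover have "min_cut V ?R F \<le> card (out_cut ?R W)" using W by (intro min_cut_le)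
  ultimately have "min_cut V ?R F < min_cut V R F" using W(4) by simp
  then show ?thesis using ray by blast
qed

text \<open>A state is a tournament with a finite closed set. A step either enlarges the closed set
  by the next vertex of the enumeration or applies one fan that lowers \<open>min_cut\<close>; so
  only finitely many fans lie between two enlargements.\<close>

lemma reorients_finite_outdegree:
  fixes en :: "nat \<Rightarrow> 'a"
  assumes T: "tournament_on V R" and fin: "\<And>v. finite (R `` {v})" and en: "V = range en"
  shows "\<exists>R' W. reorients V R R' \<and> (\<forall>n::nat. finite (W n)) \<and> V \<subseteq> (\<Union>n. W n) \<and>
    (\<forall>n. \<forall>u\<in>V - W n. \<forall>v\<in>V \<inter> W n. (u, v) \<in> R')"
proof -
  let ?push = "\<lambda>R u x. reoriented R (fan u x) UNIV"
  \<comment> \<open>If \<open>W\<close> contains all of \<open>V\<close>, the \<open>LEAST\<close>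
    is unspecified, but the vertex added still lies in \<open>V\<close>.\<close>
  define F where "F W = insert (en (LEAST j. en j \<notin> W)) W" for W
  define good where "good n s \<longleftrightarrow> (n = 0 \<longrightarrow> s = (R, {})) \<and> tournament_on V (fst s) \<and>
      (\<forall>v. finite (fst s `` {v})) \<and> finite (snd s) \<and> snd s \<subseteq> V \<and> fst s `` snd s \<subseteq> snd s"
    for n :: nat and s :: "'a rel \<times> 'a set"
  define step where "step s t \<longleftrightarrow>
      (fst t = fst s \<and> F (snd s) \<subseteq> snd t) \<or>
      (snd t = snd s \<and> min_cut V (fst t) (F (snd s)) < min_cut V (fst s) (F (snd s)) \<and>
       (\<exists>u x. ray_at (fst s) u x \<and> fst t = ?push (fst s) u x))"
    for s t :: "'a rel \<times> 'a set"
  have "\<exists>f. \<forall>n. good n (f n) \<and> step (f n) (f (Suc n))"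
  proof (rule dependent_nat_choice)
    show "\<exists>s. good 0 s" using T fin by (intro exI[of _ "(R, {})"]) (simp add: good_def)
    fix s n assume s: "good n s"
    have FV: "finite (F (snd s))" "F (snd s) \<subseteq> V" using s en by (auto simp: F_def good_def)
    have sT: "tournament_on V (fst s)" and sf: "\<And>v. finite (fst s `` {v})"
      and sW: "finite (snd s)" "snd s \<subseteq> V" "fst s `` snd s \<subseteq> snd s"
      using s by (auto simp: good_def)
    show "\<exists>t. good (Suc n) t \<and> step s t"
    proof (cases "\<exists>W. finite W \<and> F (snd s) \<subseteq> W \<and> W \<subseteq> V \<and> fst s `` W \<subseteq> W")
      case True
      then obtain W where "finite W" "F (snd s) \<subseteq> W" "W \<subseteq> V" "fst s `` W \<subseteq> W" by blast
      then have "good (Suc n) (fst s, W) \<and> step s (fst s, W)"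
        using sT sf by (simp add: good_def step_def)
      then show ?thesis by blast
    next
      case False
      from exists_cut_decreasing_ray[OF sT sf FV False] obtain u x where
        ux: "ray_at (fst s) u x" "min_cut V (?push (fst s) u x) (F (snd s)) < min_cut V (fst s) (F (snd s))"
        by blast
      have "(a, b) \<in> ?push (fst s) u x \<longleftrightarrow> (a, b) \<in> fst s" if "a \<in> snd s" for a b
      proof (rule mem_reoriented_untouched)
        show "{n \<in> UNIV. touches (fan u x n) a b} = {}"
          using fan_avoids_closed(1)[OF ux(1) sW(1,3)] that by blast
      qed
      then have "?push (fst s) u x `` snd s \<subseteq> snd s" using sW(3) by blast
      then have "good (Suc n) (?push (fst s) u x, snd s) \<and> step s (?push (fst s) u x, snd s)"
        using tournament_on_reoriented[OF sT] finite_outdegree_ray[OF ux(1) sf] sW ux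
        by (auto simp: good_def step_def)
      then show ?thesis by blast
    qed
  qed
  then obtain f where f: "\<And>n. good n (f n)" "\<And>n. step (f n) (f (Suc n))" by blast
  define Q W where "Q n = fst (f n)" and "W n = snd (f n)" for n
  have Q0: "Q 0 = R" using f(1)[of 0] by (simp add: good_def Q_def)
  have TQ: "tournament_on V (Q n)" and fW: "finite (W n)" and cl: "Q n `` W n \<subseteq> W n" for n
    using f(1)[of n] by (auto simp: good_def Q_def W_def)
  have st: "Q (Suc n) = Q n \<and> F (W n) \<subseteq> W (Suc n) \<or>
      W (Suc n) = W n \<and> min_cut V (Q (Suc n)) (F (W n)) < min_cut V (Q n) (F (W n)) \<and>
       (\<exists>u x. ray_at (Q n) u x \<and> Q (Suc n) = ?push (Q n) u x)" for n
    using f(2)[of n] by (simp add: step_def Q_def W_def)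
  have "W n \<subseteq> W (Suc n)" for n using st[of n] by (auto simp: F_def)
  then have mono: "W m \<subseteq> W n" if "m \<le> n" for m n using lift_Suc_mono_le[of W] that by blast
  \<comment> \<open>A fan step keeps \<open>W\<close>, hence the target \<open>F (W n)\<close>, and
    lowers a natural number.\<close>
  have progress: "\<exists>m\<ge>n. F (W m) \<subseteq> W (Suc m)" for n
  proof (induction "min_cut V (Q n) (F (W n))" arbitrary: n rule: less_induct)
    case less
    show ?case
    proof (cases "F (W n) \<subseteq> W (Suc n)")
      case True
      then show ?thesis by blast
    next
      case False
      then have "W (Suc n) = W n" "min_cut V (Q (Suc n)) (F (W n)) < min_cut V (Q n) (F (W n))"
        using st[of n] by auto
      then obtain m where "m \<ge> Suc n" "F (W m) \<subseteq> W (Suc m)" using less[of "Suc n"] by auto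
      then show ?thesis by (intro exI[of _ m]) auto
    qed
  qed
  have "\<exists>n. \<forall>i<j. en i \<in> W n" for j
  proof (induction j)
    case (Suc j)
    then obtain n where n: "\<forall>i<j. en i \<in> W n" by blast
    obtain m where m: "m \<ge> n" "F (W m) \<subseteq> W (Suc m)" using progress by blast
    have lt: "\<forall>i<j. en i \<in> W m" using n mono[OF m(1)] by blast
    have "en j \<in> W (Suc m)"
    proof (cases "en j \<in> W m")
      case True
      then show ?thesis using mono[of m "Suc m"] by auto
    next
      case False
      then have "(LEAST j. en j \<notin> W m) = j" using lt by (intro Least_equality) (auto simp: not_less[symmetric])
      then show ?thesis using m(2) by (auto simp: F_def)
    qed
    then show ?case using lt mono[of m "Suc m"] by (intro exI[of _ "Suc m"]) (auto simp: less_Suc_eq)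
  qed simp
  then have cover: "\<exists>n. v \<in> W n" if "v \<in> V" for v
    using that unfolding en by (metis lessI rangeE)
  define I where "I = {n. \<exists>u x. ray_at (Q n) u x \<and> Q (Suc n) = ?push (Q n) u x}"
  have "\<forall>n\<in>I. \<exists>p. ray_at (Q n) (fst p) (snd p) \<and> Q (Suc n) = ?push (Q n) (fst p) (snd p)"
    by (auto simp: I_def)
  from bchoice[OF this] obtain p where
    p: "\<And>n. n \<in> I \<Longrightarrow> ray_at (Q n) (fst (p n)) (snd (p n))"
      "\<And>n. n \<in> I \<Longrightarrow> Q (Suc n) = ?push (Q n) (fst (p n)) (snd (p n))" by blast
  have stay: "Q (Suc n) = Q n" if "n \<notin> I" for n using st[of n] that by (auto simp: I_def)
  define C where "C q = fan (fst (p (fst q))) (snd (p (fst q))) (snd q)" for q :: "nat \<times> nat"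
  have C: "C (n, i) = fan (fst (p n)) (snd (p n)) i" for n i by (simp add: C_def)
  have avoid: "a \<notin> W n" "b \<notin> W n" if "n \<in> I" "touches (C (n, i)) a b" for n i a b
    using fan_avoids_closed[OF p(1)[OF that(1)] fW cl] that(2) unfolding C by blast+
  have fin1: "finite {i. touches (C (n, i)) a b}" if "n \<in> I" for n a b
    unfolding C using p(1)[OF that] by (intro finite_fan_touches) (auto simp: ray_at_def)
  have finC: "finite {q \<in> I \<times> UNIV. touches (C q) a b}" for a b
  proof (cases "a \<in> V")
    case True
    then obtain N where N: "a \<in> W N" using cover by blast
    \<comment> \<open>Once \<open>a\<close> has entered the closed set, all further fans avoid
      it.\<close>
    have "n < N" if "n \<in> I" "touches (C (n, i)) a b" for n i
      using avoid(1)[OF that] N mono[of N n] by (meson leI subsetD)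
    then have "{q \<in> I \<times> UNIV. touches (C q) a b} \<subseteq> (SIGMA n:I \<inter> {..<N}. {i. touches (C (n, i)) a b})" by auto
    moreover have "finite (SIGMA n:I \<inter> {..<N}. {i. touches (C (n, i)) a b})"
      using fin1 by (intro finite_SigmaI) auto
    ultimately show ?thesis by (rule finite_subset)
  next
    case False
    have "\<not> touches (C (n, i)) a b" if "n \<in> I" for n i
    proof
      assume "touches (C (n, i)) a b"
      then have "(a, b) \<in> reoriented (Q n) (\<lambda>i. C (n, i)) {..<i} \<or> (b, a) \<in> reoriented (Q n) (\<lambda>i. C (n, i)) {..<i}"
        using fan_subset_reoriented[OF p(1)[OF that], of i] unfolding touches_def C by blast
      then show False
        using False tournament_onD(1,2)[OF tournament_on_reoriented[OF TQ]] by metis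
    qed
    then have "{q \<in> I \<times> UNIV. touches (C q) a b} = {}" by auto
    then show ?thesis by (simp only: finite.emptyI)
  qed
  have finC': "finite {q \<in> J. touches (C q) a b}" if "J \<subseteq> I \<times> UNIV" for J a b
    using that by (intro finite_subset[OF _ finC[of a b]]) blast
  have Q: "Q n = reoriented R C ({j\<in>I. j < n} \<times> UNIV)" for n
  proof (induction n)
    case 0
    then show ?case by (simp add: Q0)
  next
    case (Suc n)
    show ?case
    proof (cases "n \<in> I")
      case True
      then have "{j\<in>I. j < Suc n} \<times> UNIV = {j\<in>I. j < n} \<times> UNIV \<union> {n} \<times> (UNIV :: nat set)" by auto
      moreover have "reoriented R C ({j\<in>I. j < n} \<times> UNIV \<union> {n} \<times> UNIV) =
          reoriented (reoriented R C ({j\<in>I. j < n} \<times> UNIV)) C ({n} \<times> UNIV)"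
        using True by (intro reoriented_Un finC') auto
      ultimately show ?thesis using p(2)[OF True] Suc by (simp add: reoriented_slice C)
    next
      case False
      then have "{j\<in>I. j < Suc n} = {j\<in>I. j < n}" by (auto simp: less_Suc_eq)
      then show ?thesis using stay[OF False] Suc by simp
    qed
  qed
  have "reversal_run R (block_order I less_than) C"
  proof (rule block_run)
    show "wf less_than" "trans less_than" "total_on I less_than" by (auto simp: total_on_def)
    show "short_cycle (C (n, i))" if "n \<in> I" for n i
      unfolding C by (rule short_cycle_fan[OF p(1)[OF that]])
    show "C (n, i) \<subseteq> reoriented R C ({j\<in>I. (j, n) \<in> less_than} \<times> UNIV \<union> {n} \<times> {..<i})" if n: "n \<in> I" for n i
    proof -
      have "reoriented R C ({j\<in>I. j < n} \<times> UNIV \<union> {n} \<times> {..<i}) =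
          reoriented (reoriented R C ({j\<in>I. j < n} \<times> UNIV)) C ({n} \<times> {..<i})"
        using n by (intro reoriented_Un finC') auto
      then show ?thesis
        using fan_subset_reoriented[OF p(1)[OF n], of i] by (simp add: reoriented_slice C Q[symmetric])
    qed
  qed (rule finC)
  then have "reorients V R (reoriented R C (I \<times> UNIV))"
    unfolding reorients_def by (intro disjI1 exI[of _ "block_order I less_than"] exI[of _ C]) (simp add: Field_block_order)
  \<comment> \<open>From step \<open>n\<close> on no fan touches an edge at \<open>v\<close>, so its
    direction in the closed state \<open>Q n\<close> is final.\<close>
  moreover have "(u, v) \<in> reoriented R C (I \<times> UNIV)" if u: "u \<in> V - W n" and v: "v \<in> V \<inter> W n" for u v n
  proof -
    have "j < n" if "j \<in> I" "touches (C (j, i)) u v" for i j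
      using avoid(2)[OF that] v mono[of n j] by (meson IntD2 leI subsetD)
    then have "{q \<in> I \<times> UNIV. touches (C q) u v} = {q \<in> {j\<in>I. j < n} \<times> UNIV. touches (C q) u v}" by auto
    then have "(u, v) \<in> reoriented R C (I \<times> UNIV) \<longleftrightarrow> (u, v) \<in> Q n" unfolding Q mem_reoriented by simp
    moreover have "(v, u) \<notin> Q n" using cl[of n] u v by blast
    ultimately show ?thesis using tournament_onD(5)[OF TQ, of v u n] u v by auto
  qed
  moreover have "V \<subseteq> (\<Union>n. W n)" using cover by blast
  ultimately show ?thesis using fW by blast
qed

section \<open>The ordered partition\<close>

lemma reorients_dominated_sets:
  fixes k m :: "'k rel"
  assumes k: "Card_order k" "infinite (Field k)" and m: "m = cofinality k"
    and T: "tournament_on V R" and V: "|V| =o k" and deg: "\<forall>v\<in>V. |R `` {v}| <o k"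
  shows "\<exists>R' W. reorients V R R' \<and> (\<forall>\<xi>\<in>Field m. |W \<xi>| <o k) \<and> V \<subseteq> (\<Union>\<xi>\<in>Field m. W \<xi>) \<and>
    (\<forall>\<xi>\<in>Field m. \<forall>u\<in>V - W \<xi>. \<forall>v\<in>V \<inter> W \<xi>. (u, v) \<in> R')"
proof -
  note D = tournament_onD[OF T]
  have wk: "Well_order k" using k(1) by (simp add: card_order_on_def)
  have fin_less: "|X| <o k" if "finite X" for X :: "'a set"
    using finite_ordLess_infinite[OF card_of_Well_order wk, of X] that k(2) by (simp add: Field_card_of)
  have deg': "|R `` {v}| <o k" for v
  proof (cases "v \<in> V")
    case False
    then have "R `` {v} = {}" using D(1) by blast
    then show ?thesis using fin_less[of "{}"] by simp
  qed (use deg in blast)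
  \<comment> \<open>The indices in \<open>Field m\<close> are themselves the elements of a cofinal
    subset of \<open>k\<close>; the singular case relies on this.\<close>
  obtain A where A: "A \<subseteq> Field k" "cofinal A k" "m = |A|"
    using cofinality_exists[OF k] m by blast
  have Fm: "Field m = A" using A(3) by (simp add: Field_card_of)
  have Vne: "V \<noteq> {}"
  proof
    assume "V = {}"
    then have "|V| <o k" by (intro fin_less) simp
    then show False using V not_ordLess_ordIso by blast
  qed
  have "|Field k| =o k" by (rule card_of_Field_ordIso[OF k(1)])
  moreover have "natLeq \<le>o |Field k|" using k(2) infinite_iff_natLeq_ordLeq by blast
  ultimately have "natLeq \<le>o k" using ordLeq_ordIso_trans by blast
  then consider "natLeq =o k" | "natLeq <o k" "regularCard k" | "natLeq <o k" "\<not> regularCard k"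
    using ordLeq_iff_ordLess_or_ordIso by blast
  then show ?thesis
  proof cases
    case 1
    have "|UNIV :: nat set| =o |V|"
      by (rule ordIso_transitive[OF card_of_nat ordIso_transitive[OF 1 ordIso_symmetric[OF V]]])
    then obtain en :: "nat \<Rightarrow> 'a" where "bij_betw en UNIV V" using card_of_ordIso by blast
    then have en: "V = range en" by (simp add: bij_betw_def)
    have "finite (R `` {v})" for v
      unfolding finite_iff_ordLess_natLeq by (rule ordLess_ordIso_trans[OF deg' ordIso_symmetric[OF 1]])
    from reorients_finite_outdegree[OF T this en] obtain R' and W :: "nat \<Rightarrow> 'a set" where
      W: "reorients V R R'" "\<forall>n. finite (W n)" "V \<subseteq> (\<Union>n. W n)"
        "\<forall>n. \<forall>u\<in>V - W n. \<forall>v\<in>V \<inter> W n. (u, v) \<in> R'" by blast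
    have "regularCard k"
      using regularCard_ordIso[OF 1 natLeq_Cinfinite regularCard_natLeq] .
    then have "|A| =o k" using regularCard_cofinality[OF k] m A(3) by simp
    then have "|UNIV :: nat set| =o |A|"
      by (intro ordIso_transitive[OF card_of_nat ordIso_transitive[OF 1]]) (rule ordIso_symmetric)
    \<comment> \<open>A surjection suffices, since repeated sets do no harm to a cover.\<close>
    then obtain g where g: "g ` A = (UNIV :: nat set)" using card_of_surj_ordIso by blast
    have "V \<subseteq> (\<Union>\<xi>\<in>A. W (g \<xi>))"
    proof -
      have "(\<Union>\<xi>\<in>A. W (g \<xi>)) = (\<Union>n\<in>g ` A. W n)" by simp
      then show ?thesis using W(3) unfolding g by simp
    qed
    then show ?thesis
      using W(1,2,4) fin_less unfolding Fm by (intro exI[of _ R'] exI[of _ "\<lambda>\<xi>. W (g \<xi>)"]) blast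
  next
    case 2
    have "|A| =o k" using regularCard_cofinality[OF k 2(2)] m A(3) by simp
    then have "|V| =o |A|" by (intro ordIso_transitive[OF V]) (rule ordIso_symmetric)
    then obtain g where g: "g ` A = V" using card_of_surj_ordIso Vne by blast
    have Ck: "Cinfinite k" using k by (simp add: cinfinite_def)
    note UN = card_of_UNION_ordLess_infinite_Field_regularCard[OF 2(2) Ck]
    \<comment> \<open>Regularity keeps each finite number of steps below \<open>k\<close>, and
      uncountability then the union over all \<open>n\<close>.\<close>
    have pow: "|(R ^^ n) `` {a}| <o k" for n a
    proof (induction n)
      case 0
      show ?case by (rule fin_less) simp
    next
      case (Suc n)
      have "(R ^^ Suc n) `` {a} = (\<Union>y\<in>(R ^^ n) `` {a}. R `` {y})" by auto
      then show ?case using UN[OF Suc, of "\<lambda>y. R `` {y}"] deg' by simp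
    qed
    have nat: "|UNIV :: nat set| <o k" using card_of_nat 2(1) by (rule ordIso_ordLess_trans)
    have "R\<^sup>* `` {a} = (\<Union>n. (R ^^ n) `` {a})" for a by (auto simp: rtrancl_power)
    then have small: "|R\<^sup>* `` {a}| <o k" for a using UN[OF nat, of "\<lambda>n. (R ^^ n) `` {a}"] pow by simp
    have dom: "(u, v) \<in> R" if "u \<in> V - R\<^sup>* `` {a}" "v \<in> V \<inter> R\<^sup>* `` {a}" for a u v
    proof -
      have "(v, u) \<notin> R" using that rtrancl_into_rtrancl[of a v R u] by blast
      moreover have "v \<noteq> u" using that by blast
      ultimately show ?thesis using D(5)[of v u] that by blast
    qed
    have "V \<subseteq> (\<Union>\<xi>\<in>A. R\<^sup>* `` {g \<xi>})" using g by blast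
    then show ?thesis
      using small dom reorients_refl[of V R] unfolding Fm
      by (intro exI[of _ R] exI[of _ "\<lambda>\<xi>. R\<^sup>* `` {g \<xi>}"]) blast
  next
    case 3
    define B where "B = {(u, v) \<in> R. |R `` {u}| <o |R `` {v}| \<and> natLeq <o |R `` {v}|}"
    \<comment> \<open>The condition that \<open>underS k \<xi>\<close> be uncountable ensures that
      every arc from \<open>W \<xi>\<close> to its complement has a head of uncountable out-degree
      and so belongs to \<open>B\<close>.\<close>
    define W where "W \<xi> = {v\<in>V. natLeq <o |underS k \<xi>| \<and> |R `` {v}| \<le>o |underS k \<xi>|}" for \<xi>
    have small: "|W \<xi>| <o k" if x: "\<xi> \<in> A" for \<xi>
    proof (cases "natLeq <o |underS k \<xi>|")
      case False
      then have "W \<xi> = {}" by (simp add: W_def)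
      then show ?thesis using fin_less[of "{}"] by simp
    next
      case True
      let ?c = "cardSuc |underS k \<xi>|"
      have inf: "infinite (Field |underS k \<xi>| )"
        using True infinite_iff_natLeq_ordLeq ordLess_imp_ordLeq by (simp add: Field_card_of) blast
      have "|underS k \<xi>| <o k" using card_of_underS[OF k(1)] x A(1) by blast
      then have less: "?c <o k"
        by (rule cardSuc_ordLess_not_regularCard[OF k(1) 3(2) card_of_Card_order inf])
      have "|W \<xi>| \<le>o ?c"
      proof (rule card_small_outdegrees[OF T])
        show "Card_order ?c" by (rule cardSuc_Card_order[OF card_of_Card_order])
        show "infinite (Field ?c)" using inf by (simp add: cardSuc_finite card_of_Card_order)
        show "W \<xi> \<subseteq> V" by (auto simp: W_def)
        show "\<forall>v\<in>W \<xi>. |R `` {v}| <o ?c"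
          by (simp add: W_def cardSuc_ordLeq_ordLess card_of_Card_order)
      qed
      then show ?thesis using less by (rule ordLeq_ordLess_trans)
    qed
    have mono: "|underS k a| \<le>o |underS k b|" if "(a, b) \<in> k" for a b
    proof (rule card_of_mono1)
      have "trans k" "antisym k" using wk by (auto simp: order_on_defs)
      then show "underS k a \<subseteq> underS k b" using that by (auto simp: underS_def dest: transD antisymD)
    qed
    \<comment> \<open>This provides an element \<open>b\<close> with uncountably many predecessors;
      indices above it have nontrivial thresholds.\<close>
    have "cardSuc natLeq <o k"
      by (rule cardSuc_ordLess_not_regularCard[OF k(1) 3(2) natLeq_Card_order _ 3(1)]) (simp add: Field_natLeq)
    moreover have sF: "|Field (cardSuc natLeq)| =o cardSuc natLeq"
      by (rule card_of_Field_ordIso[OF cardSuc_Card_order[OF natLeq_Card_order]])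
    ultimately have "|Field (cardSuc natLeq)| <o k" using ordIso_ordLess_trans by blast
    from ordLess_card_underS[OF k(1) this] obtain b where
      b: "b \<in> Field k" "|Field (cardSuc natLeq)| \<le>o |underS k b|" by blast
    have "natLeq <o |Field (cardSuc natLeq)|"
      using cardSuc_greater[OF natLeq_Card_order] ordIso_symmetric[OF sF] by (rule ordLess_ordIso_trans)
    then have natb: "natLeq <o |underS k b|" using b(2) by (rule ordLess_ordLeq_trans)
    have cover: "\<exists>\<xi>\<in>A. v \<in> W \<xi>" if v: "v \<in> V" for v
    proof -
      from ordLess_card_underS[OF k(1) deg'[of v]] obtain a where
        a: "a \<in> Field k" "|R `` {v}| \<le>o |underS k a|" by blast
      obtain c where c: "c \<in> Field k" "(a, c) \<in> k" "(b, c) \<in> k"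
      proof (cases "(a, b) \<in> k")
        case True
        moreover have "(b, b) \<in> k" using wk b(1) by (simp add: order_on_defs refl_on_def)
        ultimately show ?thesis using that b(1) by blast
      next
        case False
        moreover have "(a, a) \<in> k" using wk a(1) by (simp add: order_on_defs refl_on_def)
        ultimately have "(b, a) \<in> k" using Well_order_total[OF wk a(1) b(1)] by metis
        then show ?thesis using that a(1) \<open>(a, a) \<in> k\<close> by blast
      qed
      obtain \<xi> where x: "\<xi> \<in> A" "(c, \<xi>) \<in> k" using A(2) c(1) by (auto simp: cofinal_def)
      have "|R `` {v}| \<le>o |underS k \<xi>|"
        by (rule ordLeq_transitive[OF a(2) ordLeq_transitive[OF mono[OF c(2)] mono[OF x(2)]]])
      moreover have "natLeq <o |underS k \<xi>|"
        by (rule ordLess_ordLeq_trans[OF natb ordLeq_transitive[OF mono[OF c(3)] mono[OF x(2)]]])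
      ultimately show ?thesis using v x(1) by (auto simp: W_def)
    qed
    have dom: "(u, v) \<in> (R - B) \<union> B\<inverse>" if u: "u \<in> V - W \<xi>" and v: "v \<in> V \<inter> W \<xi>" for u v \<xi>
    proof -
      have nat: "natLeq <o |underS k \<xi>|" and vle: "|R `` {v}| \<le>o |underS k \<xi>|" using v by (auto simp: W_def)
      have "\<not> |R `` {u}| \<le>o |underS k \<xi>|" using u nat by (auto simp: W_def)
      then have ugt: "|underS k \<xi>| <o |R `` {u}|"
        by (simp add: not_ordLeq_iff_ordLess[OF card_of_Well_order card_of_Well_order])
      have vu: "|R `` {v}| <o |R `` {u}|" by (rule ordLeq_ordLess_trans[OF vle ugt])
      have nu: "natLeq <o |R `` {u}|" by (rule ordLess_transitive[OF nat ugt])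
      show ?thesis
      proof (cases "(v, u) \<in> R")
        case True
        then have "(v, u) \<in> B" using vu nu by (simp add: B_def)
        then show ?thesis by simp
      next
        case False
        moreover have "v \<noteq> u" using u v by blast
        ultimately have "(u, v) \<in> R" using D(5)[of v u] u v by blast
        moreover have "(u, v) \<notin> B"
        proof
          assume "(u, v) \<in> B"
          then have "|R `` {u}| <o |R `` {v}|" by (simp add: B_def)
          then show False using not_ordLess_ordLeq[OF vu] ordLess_imp_ordLeq by blast
        qed
        ultimately show ?thesis by simp
      qed
    qed
    have "reorients V R ((R - B) \<union> B\<inverse>)" by (rule reorients_larger_outdegree[OF T B_def])
    moreover have "V \<subseteq> (\<Union>\<xi>\<in>A. W \<xi>)" using cover by blast
    ultimately show ?thesis
      using small dom unfolding Fm by (intro exI[of _ "(R - B) \<union> B\<inverse>"] exI[of _ W]) blast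
  qed
qed

section \<open>Back from relations to the digraph \<open>D\<close>\<close>

lemma tournament_on_parcs:
  assumes "tournament D"
  shows "tournament_on (pverts D) (parcs D)"
proof -
  interpret tournament D by (rule assms)
  have "parcs D \<subseteq> pverts D \<times> pverts D" using in_arcsD1 in_arcsD2 by (intro subrelI) blast
  moreover have "asym (parcs D)"
  proof (rule asymI)
    fix u v assume uv: "(u, v) \<in> parcs D"
    then show "(v, u) \<notin> parcs D"
      using exactly_one_arc[OF in_arcsD1[OF uv] in_arcsD2[OF uv]] pair_no_loops[OF uv] by simp
  qed
  moreover have "total_on (pverts D) (parcs D)"
    by (rule total_onI) (use exactly_one_arc in blast)
  ultimately show ?thesis by (simp add: tournament_on_def)
qed

text \<open>Both index types meet the size bound of \<open>reversal_run_realized\<close>, by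
  infinite cardinal arithmetic.\<close>

lemma reorients_realized:
  assumes D: "tournament D" and R: "reorients (pverts D) (parcs D) R'"
  shows "\<exists>S\<in>rs D. parcs (after_reversal D S) = R'"
proof -
  let ?K = "(UNIV :: nat set) <+> pverts D"
  have K: "natLeq +c |pverts D| = |?K|" by (simp add: csum_def Field_natLeq Field_card_of)
  have inf: "infinite ?K" by (simp add: finite_Plus_iff)
  have nat: "|UNIV :: nat set| \<le>o |?K|" by (rule card_of_Plus1)
  have V: "|pverts D| \<le>o |?K|" by (rule card_of_Plus2)
  have prod: "|X \<times> Y| \<le>o |?K|" if "|X| \<le>o |?K|" "|Y| \<le>o |?K|" for X :: "'c set" and Y :: "'d set"
    by (rule card_of_Times_ordLeq_infinite_Field[OF _ that card_of_Card_order]) (use inf in \<open>simp add: Field_card_of\<close>)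
  have *: ?thesis if "reversal D S E" "parcs E = R'" for S E
    using that after_reversal_eq[OF that(1)] by (intro bexI[of _ S]) (auto simp: rs_def)
  from R consider
      (nat) r :: "(nat \<times> nat) rel" and C where "reversal_run (parcs D) r C" "R' = reoriented (parcs D) C (Field r)"
    | (arcs) r :: "(('a \<times> 'a) \<times> nat) rel" and C where "Field r \<subseteq> (pverts D \<times> pverts D) \<times> UNIV"
        "reversal_run (parcs D) r C" "R' = reoriented (parcs D) C (Field r)"
    unfolding reorients_def by blast
  then show ?thesis
  proof cases
    case nat
    have "|Field r| \<le>o |(UNIV :: nat set) \<times> (UNIV :: nat set)|" by (rule card_of_mono1) simp
    then have "|Field r| \<le>o |?K|" by (rule ordLeq_transitive) (rule prod[OF \<open>|UNIV| \<le>o |?K|\<close> \<open>|UNIV| \<le>o |?K|\<close>])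
    then show ?thesis using reversal_run_realized[OF D nat(1)] nat(2) * unfolding K by metis
  next
    case arcs
    have "|Field r| \<le>o |(pverts D \<times> pverts D) \<times> (UNIV :: nat set)|" by (rule card_of_mono1[OF arcs(1)])
    then have "|Field r| \<le>o |?K|" by (rule ordLeq_transitive) (rule prod[OF prod[OF V V] nat])
    then show ?thesis using reversal_run_realized[OF D arcs(2)] arcs(3) * unfolding K by metis
  qed
qed

theorem theorem5p3:
  fixes \<kappa> \<mu> :: "'k rel" and D :: "'a pair_pre_digraph"
  assumes "Card_order \<kappa>" and "infinite (Field \<kappa>)"
    and "tournament D" and "|pverts D| =o \<kappa>"
    and "\<mu> = cofinality \<kappa>"
  shows "((\<forall>v\<in>pverts D. |out_arcs (with_proj D) v| <o \<kappa>) \<longrightarrow>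
           (\<exists>S\<in>rs D. \<exists>V. partition_on (pverts D) (V ` Field \<mu>) \<and> disjoint_family_on V (Field \<mu>) \<and>
              (\<forall>\<xi>\<in>Field \<mu>. |V \<xi>| <o \<kappa>) \<and>
              (\<forall>\<xi>\<in>Field \<mu>. \<forall>\<zeta>\<in>underS \<mu> \<xi>. \<forall>u\<in>V \<xi>. \<forall>v\<in>V \<zeta>.
                 (u, v) \<in> parcs (after_reversal D S)))) \<and>
         ((\<forall>v\<in>pverts D. |in_arcs (with_proj D) v| <o \<kappa>) \<longrightarrow>
           (\<exists>S\<in>rs D. \<exists>V. partition_on (pverts D) (V ` Field \<mu>) \<and> disjoint_family_on V (Field \<mu>) \<and>
              (\<forall>\<xi>\<in>Field \<mu>. |V \<xi>| <o \<kappa>) \<and>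
              (\<forall>\<xi>\<in>Field \<mu>. \<forall>\<zeta>\<in>underS \<mu> \<xi>. \<forall>v\<in>V \<xi>. \<forall>u\<in>V \<zeta>.
                 (u, v) \<in> parcs (after_reversal D S))))"
proof -
  let ?V = "pverts D" and ?R = "parcs D"
  have T: "tournament_on ?V ?R" by (rule tournament_on_parcs[OF assms(3)])
  \<comment> \<open>Stated for any tournament on the same vertices, to be applied to the arcs of
    \<open>D\<close> and to their converses.\<close>
  have part: "\<exists>R' P. reorients ?V R R' \<and> partition_on ?V (P ` Field \<mu>) \<and> disjoint_family_on P (Field \<mu>) \<and>
      (\<forall>\<xi>\<in>Field \<mu>. |P \<xi>| <o \<kappa>) \<and>
      (\<forall>\<xi>\<in>Field \<mu>. \<forall>\<zeta>\<in>underS \<mu> \<xi>. \<forall>u\<in>P \<xi>. \<forall>v\<in>P \<zeta>. (u, v) \<in> R')"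
    if R: "tournament_on ?V R" "\<forall>v\<in>?V. |R `` {v}| <o \<kappa>" for R
  proof -
    from reorients_dominated_sets[OF assms(1,2,5) R(1) assms(4) R(2)] obtain R' W where
      W: "reorients ?V R R'" "\<forall>\<xi>\<in>Field \<mu>. |W \<xi>| <o \<kappa>" "?V \<subseteq> (\<Union>\<xi>\<in>Field \<mu>. W \<xi>)"
        "\<forall>\<xi>\<in>Field \<mu>. \<forall>u\<in>?V - W \<xi>. \<forall>v\<in>?V \<inter> W \<xi>. (u, v) \<in> R'" by blast
    from ordered_partition_of_dominated_sets[OF assms(1,2,4,5), of W R'] W(2-4)
    show ?thesis using W(1) by blast
  qed
  show ?thesis
  proof (intro conjI impI)
    assume deg: "\<forall>v\<in>?V. |out_arcs (with_proj D) v| <o \<kappa>"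
    have "|?R `` {v}| <o \<kappa>" if "v \<in> ?V" for v
    proof -
      have "?R `` {v} = snd ` out_arcs (with_proj D) v" by (force simp: out_arcs_def)
      then have "|?R `` {v}| \<le>o |out_arcs (with_proj D) v|" using card_of_image by metis
      then show ?thesis using deg that by (blast intro: ordLeq_ordLess_trans)
    qed
    then obtain R' P where P: "reorients ?V ?R R'" "partition_on ?V (P ` Field \<mu>)"
        "disjoint_family_on P (Field \<mu>)" "\<forall>\<xi>\<in>Field \<mu>. |P \<xi>| <o \<kappa>"
        "\<forall>\<xi>\<in>Field \<mu>. \<forall>\<zeta>\<in>underS \<mu> \<xi>. \<forall>u\<in>P \<xi>. \<forall>v\<in>P \<zeta>. (u, v) \<in> R'"
      using part[OF T] by blast
    obtain S where S: "S \<in> rs D" "parcs (after_reversal D S) = R'"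
      using reorients_realized[OF assms(3) P(1)] by blast
    then show "\<exists>S\<in>rs D. \<exists>V. partition_on ?V (V ` Field \<mu>) \<and> disjoint_family_on V (Field \<mu>) \<and>
              (\<forall>\<xi>\<in>Field \<mu>. |V \<xi>| <o \<kappa>) \<and>
              (\<forall>\<xi>\<in>Field \<mu>. \<forall>\<zeta>\<in>underS \<mu> \<xi>. \<forall>u\<in>V \<xi>. \<forall>v\<in>V \<zeta>.
                 (u, v) \<in> parcs (after_reversal D S))"
      using P(2-5) by (intro bexI[of _ S] exI[of _ P]) simp
  next
    assume deg: "\<forall>v\<in>?V. |in_arcs (with_proj D) v| <o \<kappa>"
    have "|?R\<inverse> `` {v}| <o \<kappa>" if "v \<in> ?V" for v
    proof -
      have "?R\<inverse> `` {v} = fst ` in_arcs (with_proj D) v" by (force simp: in_arcs_def)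
      then have "|?R\<inverse> `` {v}| \<le>o |in_arcs (with_proj D) v|" using card_of_image by metis
      then show ?thesis using deg that by (blast intro: ordLeq_ordLess_trans)
    qed
    then obtain R' P where P: "reorients ?V (?R\<inverse>) R'" "partition_on ?V (P ` Field \<mu>)"
        "disjoint_family_on P (Field \<mu>)" "\<forall>\<xi>\<in>Field \<mu>. |P \<xi>| <o \<kappa>"
        "\<forall>\<xi>\<in>Field \<mu>. \<forall>\<zeta>\<in>underS \<mu> \<xi>. \<forall>u\<in>P \<xi>. \<forall>v\<in>P \<zeta>. (u, v) \<in> R'"
      using part[OF tournament_on_converse[OF T]] by blast
    \<comment> \<open>The run found for the converse tournament becomes a run for \<open>D\<close>
      when its cycles are reversed.\<close>
    have "reorients ?V ?R (R'\<inverse>)" using reorients_converse[OF P(1)] by simp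
    then obtain S where S: "S \<in> rs D" "parcs (after_reversal D S) = R'\<inverse>"
      using reorients_realized[OF assms(3)] by blast
    then show "\<exists>S\<in>rs D. \<exists>V. partition_on ?V (V ` Field \<mu>) \<and> disjoint_family_on V (Field \<mu>) \<and>
              (\<forall>\<xi>\<in>Field \<mu>. |V \<xi>| <o \<kappa>) \<and>
              (\<forall>\<xi>\<in>Field \<mu>. \<forall>\<zeta>\<in>underS \<mu> \<xi>. \<forall>v\<in>V \<xi>. \<forall>u\<in>V \<zeta>.
                 (u, v) \<in> parcs (after_reversal D S))"
      using P(2-5) by (intro bexI[of _ S] exI[of _ P]) simp
  qed
qed

end
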